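(* Let $n\ge1$. The map $\psi_B=\varphi_B\circ\phi^{\mathrm{NC}}_B$ is a bijection between $\mathrm{NC}_B(n)$ and $\mathfrak{B}(n)$. Moreover, if $\psi_B(\pi)=(\sigma,x)$, then $\operatorname{type}(\pi)=\operatorname{type}(\sigma)$ if $x$ is not a block, and $\operatorname{type}(\pi)=\operatorname{type}(\sigma\setminus\{x\})$ if $x$ is a block.
   Context: $[n]=\{1,\dots,n\}$, $[\pm n]=\{\pm1,\dots,\pm n\}$. An edge of a partition of a set of integers is a pair $(i,j)$, $i<j$, in the same block with no element of that block strictly between. $\mathrm{NC}(n)$: partitions of $[n]$ with no two edges $(a,b),(c,d)$, $a<c<b<d$. A block $B$ of $\sigma$ is nonnested if no edge $(i,j)$ satisfies $i<\min B\le\max B<j$. $\mathrm{NC}^{\mathrm{NN}}(n)$ is the set of pairs $(\sigma,X)$ with $\sigma\in\mathrm{NC}(n)$ and $X$ a set of nonnested blocks of $\sigma$. A partition of type $B_n$ is a set partition of $[\pm n]$ with $-B$ a block whenever $B$ is and at most one block (zero block) with $B=-B$. $\mathrm{NC}_B(n)$ is the set of such partitions $\pi$ with no $i<j<k<l$ such that $a_i,a_k\in B$, $a_j,a_l\in B'$ for distinct blocks $B,B'$, where $a_1,\dots,a_{2n}$ is the sequence $1,2,\dots,n,-1,-2,\dots,-n$. $\phi^{\mathrm{NC}}_B(\pi)=(\sigma,X)$, where $\sigma$ is obtained from $\pi$ by deleting negative integers and $X$ is the set of blocks of $\sigma$ properly contained in blocks of $\pi$. $\mathfrak B(n)$ is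 the set of pairs $(\sigma,x)$ with $\sigma\in\mathrm{NC}(n)$ and $x$ either $\emptyset$, an edge of $\sigma$, or a block of $\sigma$. For $(\sigma,X)\in\mathrm{NC}^{\mathrm{NN}}(n)$ with $X=\{A_1,\dots,A_k\}$, $\max A_1<\cdots<\max A_k$, $\varphi_B(\sigma,X)=(\sigma',x)$ where $\sigma'$ is obtained from $\sigma$ by replacing $A_i$ and $A_{k+1-i}$ by their union for $i=1,\dots,\lfloor k/2\rfloor$, and $x=\emptyset$ if $k=0$, $x=(\max A_t,\min A_{t+1})$ if $k=2t\ne0$, $x=A_{t+1}$ if $k=2t+1$. Types: type of a collection of sets = multiset of their sizes; type of a partition $\pi$ of type $B_n$ = multiset containing $i$ with multiplicity the number of unordered pairs $\{B,-B\}$ of nonzero blocks of size $i$. *)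

theory Defs
  imports "HOL-Library.Disjoint_Sets" "HOL-Library.Multiset"
begin

text \<open>
  All set partitions are represented by their sets of blocks, as sets of sets of integers.
  Partitions of \<open>[n]\<close> are also sets of integer sets, so that they can be compared with
  the partitions of \<open>[\<plusminus>n]\<close> they arise from.
\<close>

definition pm_interval :: "nat \<Rightarrow> int set" where
  "pm_interval n = {- int n..int n} - {0}"

definition edges :: "int set set \<Rightarrow> (int \<times> int) set" where
  "edges \<sigma> = {(i, j). i < j \<and> (\<exists>B\<in>\<sigma>. i \<in> B \<and> j \<in> B \<and> \<not> (\<exists>k\<in>B. i < k \<and> k < j))}"

definition NC :: "nat \<Rightarrow> int set set set" where
  "NC n = {\<sigma>. partition_on {1..int n} \<sigma> \<and>
     \<not> (\<exists>a b c d. (a, b) \<in> edges \<sigma> \<and> (c, d) \<in> edges \<sigma> \<and> a < c \<and> c < b \<and> b < d)}"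

definition nonnested :: "int set set \<Rightarrow> int set \<Rightarrow> bool" where
  "nonnested \<sigma> B \<longleftrightarrow> \<not> (\<exists>(i, j)\<in>edges \<sigma>. i < Min B \<and> Max B < j)"

definition NC_NN :: "nat \<Rightarrow> (int set set \<times> int set set) set" where
  "NC_NN n = {(\<sigma>, X). \<sigma> \<in> NC n \<and> X \<subseteq> {B \<in> \<sigma>. nonnested \<sigma> B}}"

definition neg_set :: "int set \<Rightarrow> int set" where
  "neg_set B = uminus ` B"

definition partition_B :: "nat \<Rightarrow> int set set \<Rightarrow> bool" where
  "partition_B n \<pi> \<longleftrightarrow> partition_on (pm_interval n) \<pi> \<and>
     (\<forall>B\<in>\<pi>. neg_set B \<in> \<pi>) \<and>
     (\<forall>B\<in>\<pi>. \<forall>C\<in>\<pi>. B = neg_set B \<and> C = neg_set C \<longrightarrow> B = C)"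

text \<open>The sequence \<open>1, 2, \<dots>, n, -1, -2, \<dots>, -n\<close>, with indices \<open>1, \<dots>, 2 * n\<close>.\<close>

definition B_seq :: "nat \<Rightarrow> nat \<Rightarrow> int" where
  "B_seq n i = (if i \<le> n then int i else - int (i - n))"

definition NC_B :: "nat \<Rightarrow> int set set set" where
  "NC_B n = {\<pi>. partition_B n \<pi> \<and>
     \<not> (\<exists>i j k l. 1 \<le> i \<and> i < j \<and> j < k \<and> k < l \<and> l \<le> 2 * n \<and>
          (\<exists>B\<in>\<pi>. \<exists>C\<in>\<pi>. B \<noteq> C \<and> B_seq n i \<in> B \<and> B_seq n k \<in> B \<and>
             B_seq n j \<in> C \<and> B_seq n l \<in> C))}"

definition delete_negatives :: "int set set \<Rightarrow> int set set" where
  "delete_negatives \<pi> = (\<lambda>B. {b \<in> B. \<not> b < 0}) ` \<pi> - {{}}"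

text \<open>For \<open>\<pi> \<in> NC_B n\<close> the following pair lies in \<open>NC_NN n\<close>.\<close>

definition phi_NC_B :: "int set set \<Rightarrow> int set set \<times> int set set" where
  "phi_NC_B \<pi> = (delete_negatives \<pi>, {A \<in> delete_negatives \<pi>. \<exists>B\<in>\<pi>. A \<subset> B})"

datatype mark = No_Mark | Edge_Mark "int \<times> int" | Block_Mark "int set"

definition NC_marked :: "nat \<Rightarrow> (int set set \<times> mark) set" where
  "NC_marked n = {(\<sigma>, x). \<sigma> \<in> NC n \<and>
     (case x of No_Mark \<Rightarrow> True | Edge_Mark e \<Rightarrow> e \<in> edges \<sigma> | Block_Mark A \<Rightarrow> A \<in> \<sigma>)}"

text \<open>
  \<open>nth_block X i\<close> is the block \<open>A\<^sub>i\<close>, \<open>1 \<le> i \<le> card X\<close>, when the blocks in \<open>X\<close> are listed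
  by increasing maximum. The sorted list is the intended one because \<open>Max\<close> is injective on
  finite families of pairwise disjoint, nonempty finite sets.
\<close>

definition nth_block :: "int set set \<Rightarrow> nat \<Rightarrow> int set" where
  "nth_block X i = sorted_key_list_of_set Max X ! (i - 1)"

text \<open>Only meaningful on \<open>NC_NN n\<close>.\<close>

definition phi_B :: "int set set \<times> int set set \<Rightarrow> int set set \<times> mark" where
  "phi_B = (\<lambda>(\<sigma>, X).
     let k = card X; t = k div 2; A = nth_block X in
       ((\<sigma> - (\<Union>i\<in>{1..t}. {A i, A (k + 1 - i)})) \<union> (\<lambda>i. A i \<union> A (k + 1 - i)) ` {1..t},
        if k = 0 then No_Mark
        else if even k then Edge_Mark (Max (A t), Min (A (t + 1)))
        else Block_Mark (A (t + 1))))"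

definition psi_B :: "int set set \<Rightarrow> int set set \<times> mark" where
  "psi_B = phi_B \<circ> phi_NC_B"

definition type_of_sets :: "int set set \<Rightarrow> nat multiset" where
  "type_of_sets \<sigma> = image_mset card (mset_set \<sigma>)"

definition type_of_B :: "int set set \<Rightarrow> nat multiset" where
  "type_of_B \<pi> =
     Abs_multiset (\<lambda>i. card {{B, neg_set B} |B. B \<in> \<pi> \<and> B \<noteq> neg_set B \<and> card B = i})"

lemma count_type_of_B:
  assumes "finite \<pi>"
  shows "count (type_of_B \<pi>) i =
    card {{B, neg_set B} |B. B \<in> \<pi> \<and> B \<noteq> neg_set B \<and> card B = i}"
proof -
  have "{i. 0 < card {{B, neg_set B} |B. B \<in> \<pi> \<and> B \<noteq> neg_set B \<and> card B = i}} \<subseteq> card ` \<pi>"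
    by (auto simp: card_gt_0_iff)
  then show ?thesis
    unfolding type_of_B_def
    by (subst count_Abs_multiset) (use assms finite_subset in blast)+
qed

lemma (in linorder) sorted_key_list_of_set_inj_on:
  assumes "inj_on f X" "finite X"
  shows "set (sorted_key_list_of_set f X) = X"
    and "sorted_wrt (<) (map f (sorted_key_list_of_set f X))"
proof -
  interpret I: folding_insort_key "(\<le>)" "(<)" X f
    using assms(1) by unfold_locales
  show "set (sorted_key_list_of_set f X) = X"
    using I.set_sorted_key_list_of_set[OF subset_refl assms(2)] .
  show "sorted_wrt (<) (map f (sorted_key_list_of_set f X))"
    using I.strict_sorted_key_list_of_set[OF subset_refl] .
qed

lemma sorted_key_list_of_set_Max:
  fixes X :: "int set set"
  assumes "finite X" "disjoint X" and fin: "\<And>B. B \<in> X \<Longrightarrow> finite B \<and> B \<noteq> {}"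
  shows "set (sorted_key_list_of_set Max X) = X"
    and "sorted_wrt (\<lambda>A B. Max A < Max B) (sorted_key_list_of_set Max X)"
proof -
  have inj: "inj_on Max X"
  proof (rule inj_onI)
    fix A B assume *: "A \<in> X" "B \<in> X" "Max A = Max B"
    then have "Max A \<in> A" "Max A \<in> B"
      using fin Max_in by metis+
    with * \<open>disjoint X\<close> show "A = B"
      unfolding disjoint_def by blast
  qed
  show "set (sorted_key_list_of_set Max X) = X"
    using sorted_key_list_of_set_inj_on(1)[OF inj \<open>finite X\<close>] .
  show "sorted_wrt (\<lambda>A B. Max A < Max B) (sorted_key_list_of_set Max X)"
    using sorted_key_list_of_set_inj_on(2)[OF inj \<open>finite X\<close>] by (simp only: sorted_wrt_map)
qed

end

theory Submission
  imports Defs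
begin

text \<open>
  Composing the two maps, the partition \<open>\<sigma>\<close> of \<open>psi_B \<pi> = (\<sigma>, x)\<close> consists of the sets of absolute
  values of the blocks of \<open>\<pi>\<close>. Indeed, by noncrossingness \<open>B \<mapsto> - B\<close> reverses the order of the
  positive parts of the blocks with elements of both signs, so that it exchanges \<open>A\<^sub>i\<close> and
  \<open>A\<^bsub>k+1-i\<^esub>\<close>. The mark records the zero block or, if there is none, the innermost pair \<open>c < d\<close>
  with \<open>c\<close> and \<open>- d\<close> in one block; this determines how to put the signs back.
  The statement on types holds because taking absolute values is injective on nonzero blocks and
  identifies exactly \<open>B\<close> with \<open>- B\<close>.
\<close>

section \<open>Noncrossing conditions in terms of blocks\<close>

text \<open>Put the terms of \<open>B_seq\<close> on a circle, so that negation is the half turn.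
  For noncrossing \<open>\<pi>\<close> some diameter is crossed by no block other than the zero
  block. It cuts the circle into two halves that negation interchanges, and \<open>abs\<close>
  identifies each half with \<open>{1..int n}\<close> up to rotation. Crossing is invariant under
  rotation, so away from the zero block noncrossingness of \<open>\<pi>\<close> and of
  \<open>\<sigma>\<close> become the same condition. What \<open>\<sigma>\<close> forgets is the
  position of the diameter, and the mark supplies it. The obstacle is that \<open>phi_B\<close>
  reads the mark off a sorted list, which is awkward for a partition built from a given marked one.
  The relation \<open>is_mark\<close> avoids this: it speaks of \<open>\<pi>\<close> alone,
  \<open>snd (psi_B \<pi>)\<close> satisfies it, and at most one mark does. Hence both composites
  with the inverse need only \<open>is_mark\<close>, and the sorted list of blocks is met only in
  \<open>phi_B_involution\<close>.\<close>

definition cpos :: "nat \<Rightarrow> int \<Rightarrow> int" where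
  "cpos n x = (if 0 < x then x else int n - x)"

definition pos_part :: "int set \<Rightarrow> int set" where
  "pos_part B = {b \<in> B. \<not> b < 0}"

lemma mem_neg_set [simp]: "x \<in> neg_set B \<longleftrightarrow> - x \<in> B"
  unfolding neg_set_def by force

lemma neg_set_neg_set [simp]: "neg_set (neg_set B) = B"
  by auto

lemma cpos_B_seq: "\<lbrakk>1 \<le> i; i \<le> 2 * n\<rbrakk> \<Longrightarrow> cpos n (B_seq n i) = int i"
  by (auto simp: cpos_def B_seq_def)

lemma B_seq_cpos:
  assumes "x \<noteq> 0" "\<bar>x\<bar> \<le> int n"
  shows "B_seq n (nat (cpos n x)) = x" "1 \<le> nat (cpos n x)" "nat (cpos n x) \<le> 2 * n"
  using assms by (auto simp: cpos_def B_seq_def)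

lemma partition_BD:
  assumes "partition_B n \<pi>"
  shows partition_B_elem: "\<And>B x. \<lbrakk>B \<in> \<pi>; x \<in> B\<rbrakk> \<Longrightarrow> x \<noteq> 0 \<and> \<bar>x\<bar> \<le> int n"
    and partition_B_cover: "\<And>x. \<lbrakk>x \<noteq> 0; \<bar>x\<bar> \<le> int n\<rbrakk> \<Longrightarrow> \<exists>B\<in>\<pi>. x \<in> B"
    and partition_B_unique: "\<And>B C x. \<lbrakk>B \<in> \<pi>; C \<in> \<pi>; x \<in> B; x \<in> C\<rbrakk> \<Longrightarrow> B = C"
    and partition_B_neg: "\<And>B. B \<in> \<pi> \<Longrightarrow> neg_set B \<in> \<pi>"
    and partition_B_zero: "\<And>B C. \<lbrakk>B \<in> \<pi>; C \<in> \<pi>; neg_set B = B; neg_set C = C\<rbrakk> \<Longrightarrow> B = C"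
    and partition_B_nonempty: "\<And>B. B \<in> \<pi> \<Longrightarrow> B \<noteq> {}"
    and partition_B_finite_block: "\<And>B. B \<in> \<pi> \<Longrightarrow> finite B"
    and partition_B_finite: "finite \<pi>"
proof -
  have p: "partition_on (pm_interval n) \<pi>" and neg: "\<forall>B\<in>\<pi>. neg_set B \<in> \<pi>"
    and zero: "\<forall>B\<in>\<pi>. \<forall>C\<in>\<pi>. B = neg_set B \<and> C = neg_set C \<longrightarrow> B = C"
    using assms unfolding partition_B_def by blast+
  have U: "\<Union>\<pi> = pm_interval n" and dis: "disjoint \<pi>" and ne: "{} \<notin> \<pi>"
    using p unfolding partition_on_def by auto
  have fin: "finite (pm_interval n)" by (simp add: pm_interval_def)
  show "x \<noteq> 0 \<and> \<bar>x\<bar> \<le> int n" if "B \<in> \<pi>" "x \<in> B" for B x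
  proof -
    have "x \<in> pm_interval n" using that U by blast
    then show ?thesis by (auto simp: pm_interval_def)
  qed
  show "\<exists>B\<in>\<pi>. x \<in> B" if "x \<noteq> 0" "\<bar>x\<bar> \<le> int n" for x
  proof -
    have "x \<in> pm_interval n" using that by (auto simp: pm_interval_def)
    then show ?thesis using U by blast
  qed
  show "B = C" if "B \<in> \<pi>" "C \<in> \<pi>" "x \<in> B" "x \<in> C" for B C x
    using dis that unfolding disjoint_def by blast
  show "neg_set B \<in> \<pi>" if "B \<in> \<pi>" for B using neg that by blast
  show "B = C" if "B \<in> \<pi>" "C \<in> \<pi>" "neg_set B = B" "neg_set C = C" for B C
    using zero that by metis
  show "B \<noteq> {}" if "B \<in> \<pi>" for B using ne that by blast
  show "finite B" if "B \<in> \<pi>" for B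
    by (rule finite_subset[OF _ fin]) (use that U in blast)
  show "finite \<pi>" using finite_elements[OF fin p] .
qed

text \<open>\<open>neg_set B\<close> is a block too and shares \<open>x\<close> with
  \<open>B\<close>. So an antipodal pair occurs only in the zero block.\<close>

lemma partition_B_zeroI:
  assumes "partition_B n \<pi>" "B \<in> \<pi>" "x \<in> B" "- x \<in> B"
  shows "neg_set B = B"
  using partition_B_unique[OF assms(1), of "neg_set B" B x] partition_B_neg[OF assms(1)] assms by auto

text \<open>\<open>cpos\<close> inverts \<open>B_seq\<close> on the nonzero integers of absolute
  value at most \<open>n\<close>, so quadruples of indices and of elements correspond. From here on
  a crossing is a chain of linear inequalities in which negatives are shifted past
  \<open>n\<close>.\<close>

lemma NC_B_iff:
  "\<pi> \<in> NC_B n \<longleftrightarrow> partition_B n \<pi> \<and>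
    (\<forall>B\<in>\<pi>. \<forall>C\<in>\<pi>. \<forall>a\<in>B. \<forall>b\<in>B. \<forall>c\<in>C. \<forall>d\<in>C.
       cpos n a < cpos n c \<and> cpos n c < cpos n b \<and> cpos n b < cpos n d \<longrightarrow> B = C)"
  (is "_ \<longleftrightarrow> _ \<and> ?nc")
proof -
  have "?nc \<longleftrightarrow> \<not> (\<exists>i j k l. 1 \<le> i \<and> i < j \<and> j < k \<and> k < l \<and> l \<le> 2 * n \<and>
          (\<exists>B\<in>\<pi>. \<exists>C\<in>\<pi>. B \<noteq> C \<and> B_seq n i \<in> B \<and> B_seq n k \<in> B \<and>
             B_seq n j \<in> C \<and> B_seq n l \<in> C))" (is "_ \<longleftrightarrow> \<not> ?cr")
    if p: "partition_B n \<pi>"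
  proof
    assume nc: ?nc
    show "\<not> ?cr"
    proof
      assume ?cr
      then obtain i j k l B C where *: "1 \<le> i" "i < j" "j < k" "k < l" "l \<le> 2 * n"
        "B \<in> \<pi>" "C \<in> \<pi>" "B \<noteq> C" "B_seq n i \<in> B" "B_seq n k \<in> B" "B_seq n j \<in> C" "B_seq n l \<in> C"
        by blast
      have "cpos n (B_seq n i) < cpos n (B_seq n j) \<and> cpos n (B_seq n j) < cpos n (B_seq n k) \<and>
        cpos n (B_seq n k) < cpos n (B_seq n l)"
        using *(1-5) by (simp add: cpos_B_seq)
      then have "B = C"
        using nc[rule_format, OF *(6,7,9,10,11,12)] by blast
      with *(8) show False ..
    qed
  next
    assume ncr: "\<not> ?cr"
    show ?nc
    proof (intro ballI impI, rule ccontr)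
      fix B C a b c d
      assume *: "B \<in> \<pi>" "C \<in> \<pi>" "a \<in> B" "b \<in> B" "c \<in> C" "d \<in> C" "B \<noteq> C"
        and lt: "cpos n a < cpos n c \<and> cpos n c < cpos n b \<and> cpos n b < cpos n d"
      note e = partition_B_elem[OF p]
      have s: "B_seq n (nat (cpos n a)) = a" "B_seq n (nat (cpos n b)) = b"
        "B_seq n (nat (cpos n c)) = c" "B_seq n (nat (cpos n d)) = d"
        "1 \<le> nat (cpos n a)" "nat (cpos n d) \<le> 2 * n"
        using e[OF *(1,3)] e[OF *(1,4)] e[OF *(2,5)] e[OF *(2,6)] by (simp_all add: B_seq_cpos del: One_nat_def)
      have "nat (cpos n a) < nat (cpos n c)" "nat (cpos n c) < nat (cpos n b)"
        "nat (cpos n b) < nat (cpos n d)"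
        using lt s(5) by linarith+
      moreover have "\<exists>B\<in>\<pi>. \<exists>C\<in>\<pi>. B \<noteq> C \<and> B_seq n (nat (cpos n a)) \<in> B \<and> B_seq n (nat (cpos n b)) \<in> B \<and>
             B_seq n (nat (cpos n c)) \<in> C \<and> B_seq n (nat (cpos n d)) \<in> C"
        using * s(1-4) by auto
      ultimately have ?cr using s(5,6) by blast
      with ncr show False ..
    qed
  qed
  then show ?thesis unfolding NC_B_def by (simp only: mem_Collect_eq cong: conj_cong)
qed

lemma NC_B_partition: "\<pi> \<in> NC_B n \<Longrightarrow> partition_B n \<pi>"
  by (simp add: NC_B_iff)

lemma NC_B_noncrossing:
  assumes "\<pi> \<in> NC_B n" "B \<in> \<pi>" "C \<in> \<pi>" "a \<in> B" "b \<in> B" "c \<in> C" "d \<in> C"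
    and "cpos n a < cpos n c" "cpos n c < cpos n b" "cpos n b < cpos n d"
  shows "B = C"
  using assms unfolding NC_B_iff by blast

lemma greatest_below:
  fixes c :: "'a :: linorder"
  assumes "finite S" "a \<in> S" "a < c"
  shows "\<exists>m\<in>S. m < c \<and> (\<forall>x\<in>S. x < c \<longrightarrow> x \<le> m)"
proof -
  have "finite {x \<in> S. x < c}" "{x \<in> S. x < c} \<noteq> {}"
    using assms by auto
  from Max_in[OF this] Max_ge[OF this(1)] show ?thesis by blast
qed

lemma least_above:
  fixes c :: "'a :: linorder"
  assumes "finite S" "b \<in> S" "c < b"
  shows "\<exists>m\<in>S. c < m \<and> (\<forall>x\<in>S. c < x \<longrightarrow> m \<le> x)"
proof -
  have "finite {x \<in> S. c < x}" "{x \<in> S. c < x} \<noteq> {}"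
    using assms by auto
  from Min_in[OF this] Min_le[OF this(1)] show ?thesis by blast
qed

text \<open>\<open>NC\<close> forbids only crossing edges, so crossing elements have to be shrunk to
  edges: \<open>(a', b')\<close> is the edge of \<open>S\<close> passing over \<open>c\<close>, and
  \<open>(c', d')\<close> the edge of \<open>T\<close> passing over \<open>b'\<close>.\<close>

lemma NC_noncrossing:
  assumes "\<sigma> \<in> NC n" "S \<in> \<sigma>" "T \<in> \<sigma>" "a \<in> S" "b \<in> S" "c \<in> T" "d \<in> T" "a < c" "c < b" "b < d"
  shows "S = T"
proof (rule ccontr)
  assume neq: "S \<noteq> T"
  have p: "partition_on {1..int n} \<sigma>" and
    nc: "\<And>a b c d. \<lbrakk>(a, b) \<in> edges \<sigma>; (c, d) \<in> edges \<sigma>; a < c; c < b; b < d\<rbrakk> \<Longrightarrow> False"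
    using assms(1) unfolding NC_def by blast+
  have dis: "\<And>x. x \<in> S \<Longrightarrow> x \<in> T \<Longrightarrow> False"
    using p neq assms(2,3) unfolding partition_on_def disjoint_def by blast
  have fin: "finite S" "finite T"
    using finite_subset[of _ "{1..int n}"] p assms(2,3) unfolding partition_on_def by blast+
  obtain a' where a': "a' \<in> S" "a' < c" "\<And>x. x \<in> S \<Longrightarrow> x < c \<Longrightarrow> x \<le> a'"
    using greatest_below[OF fin(1) assms(4,8)] by blast
  obtain b' where b': "b' \<in> S" "c < b'" "\<And>x. x \<in> S \<Longrightarrow> c < x \<Longrightarrow> b' \<le> x"
    using least_above[OF fin(1) assms(5,9)] by blast
  have "b' < d" using b'(3)[OF assms(5,9)] assms(10) by simp
  \<comment> \<open>Searching around \<open>b'\<close> rather than \<open>c\<close> keeps the edges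
    crossing: \<open>c\<close> is itself a candidate for \<open>c'\<close>, whence
    \<open>a' < c \<le> c'\<close>.\<close>
  obtain c' where c': "c' \<in> T" "c' < b'" "\<And>x. x \<in> T \<Longrightarrow> x < b' \<Longrightarrow> x \<le> c'"
    using greatest_below[OF fin(2) assms(6) b'(2)] by blast
  obtain d' where d': "d' \<in> T" "b' < d'" "\<And>x. x \<in> T \<Longrightarrow> b' < x \<Longrightarrow> d' \<le> x"
    using least_above[OF fin(2) assms(7) \<open>b' < d\<close>] by blast
  have "\<not> (\<exists>k\<in>S. a' < k \<and> k < b')"
    using a'(3) b'(3) dis assms(6) by (metis linorder_not_less linorder_neqE)
  then have "(a', b') \<in> edges \<sigma>"
    using a'(1,2) b'(1,2) assms(2) unfolding edges_def by auto
  moreover have "\<not> (\<exists>k\<in>T. c' < k \<and> k < d')"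
    using c'(3) d'(3) dis b'(1) by (metis linorder_not_less linorder_neqE)
  then have "(c', d') \<in> edges \<sigma>"
    using c'(1,2) d'(1,2) assms(3) unfolding edges_def by auto
  moreover have "a' < c'" using a'(2) c'(3)[OF assms(6) b'(2)] by simp
  ultimately show False using nc c'(2) d'(2) by blast
qed

lemma NC_I:
  assumes "partition_on {1..int n} \<sigma>"
    and nc: "\<And>S T a b c d. \<lbrakk>S \<in> \<sigma>; T \<in> \<sigma>; a \<in> S; b \<in> S; c \<in> T; d \<in> T; a < c; c < b; b < d\<rbrakk> \<Longrightarrow> S = T"
  shows "\<sigma> \<in> NC n"
proof -
  have False if "(a, b) \<in> edges \<sigma>" "(c, d) \<in> edges \<sigma>" "a < c" "c < b" "b < d" for a b c d
  proof -
    obtain S where S: "S \<in> \<sigma>" "a \<in> S" "b \<in> S" "\<not> (\<exists>k\<in>S. a < k \<and> k < b)"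
      using \<open>(a, b) \<in> edges \<sigma>\<close> unfolding edges_def by blast
    obtain T where T: "T \<in> \<sigma>" "c \<in> T" "d \<in> T"
      using \<open>(c, d) \<in> edges \<sigma>\<close> unfolding edges_def by blast
    show False using nc[OF S(1) T(1) S(2,3) T(2,3)] S T that by blast
  qed
  with assms(1) show ?thesis unfolding NC_def by blast
qed

section \<open>Marks\<close>

text \<open>
  The mark in terms of pairs \<open>c\<close>, \<open>- d\<close> in a common block: an edge mark \<open>(a, b)\<close> is the
  innermost such pair with \<open>c < d\<close>.
\<close>

fun is_mark :: "int set set \<Rightarrow> mark \<Rightarrow> bool" where
  "is_mark \<pi> No_Mark \<longleftrightarrow> (\<forall>B\<in>\<pi>. \<forall>c d. 0 < c \<and> 0 < d \<longrightarrow> \<not> (c \<in> B \<and> - d \<in> B))"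
| "is_mark \<pi> (Edge_Mark (a, b)) \<longleftrightarrow> (\<forall>B\<in>\<pi>. neg_set B \<noteq> B) \<and> 0 < a \<and> a < b \<and>
     (\<exists>B\<in>\<pi>. a \<in> B \<and> - b \<in> B) \<and>
     (\<forall>B\<in>\<pi>. \<forall>c d. 0 < c \<and> c < d \<and> c \<in> B \<and> - d \<in> B \<longrightarrow> c \<le> a \<and> b \<le> d)"
| "is_mark \<pi> (Block_Mark A) \<longleftrightarrow> (\<exists>Z\<in>\<pi>. neg_set Z = Z \<and> A = pos_part Z)"

text \<open>The three kinds exclude each other: a zero block contains some \<open>c\<close> and
  \<open>- c\<close>, and an edge mark needs a pair \<open>a\<close>, \<open>- b\<close> but no zero
  block. Two edge marks are each at least as far inside as the other. This is what allows the mark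
  of \<open>psi_B\<close> to be identified without computing it.\<close>

lemma is_mark_unique:
  assumes p: "partition_B n \<pi>" and "is_mark \<pi> x" "is_mark \<pi> y"
  shows "x = y"
proof -
  have zero: "\<exists>c>0. c \<in> Z \<and> - c \<in> Z" if "Z \<in> \<pi>" "neg_set Z = Z" for Z
  proof -
    have "Z \<noteq> {}" using partition_B_nonempty[OF p that(1)] .
    then obtain z where z: "z \<in> Z" by blast
    then have "- z \<in> Z" using that(2) mem_neg_set[of z Z] by simp
    then show ?thesis using z partition_B_elem[OF p that(1) z]
      by (cases "0 < z") (auto intro: exI[of _ "- z"])
  qed
  have *: False if "is_mark \<pi> No_Mark" "is_mark \<pi> (Block_Mark A)" for A
    using that zero by fastforce
  have **: False if "is_mark \<pi> No_Mark" "is_mark \<pi> (Edge_Mark (a, b))" for a b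
    using that by (force dest: order.strict_trans)
  have ***: False if "is_mark \<pi> (Block_Mark A)" "is_mark \<pi> (Edge_Mark (a, b))" for a b A
    using that by auto
  have eq: "a = a' \<and> b = b'"
    if "is_mark \<pi> (Edge_Mark (a, b))" "is_mark \<pi> (Edge_Mark (a', b'))" for a b a' b'
  proof -
    have "a' \<le> a \<and> b \<le> b'" "a \<le> a' \<and> b' \<le> b"
      using that by auto
    then show ?thesis by auto
  qed
  show ?thesis
  proof (cases x)
    case No_Mark
    then show ?thesis using assms(2,3) * ** by (metis mark.exhaust surj_pair)
  next
    case (Block_Mark A)
    have "A = C" if "y = Block_Mark C" for C
      using that Block_Mark assms(2,3) partition_B_zero[OF p] by (metis is_mark.simps(3))
    then show ?thesis using assms(2,3) Block_Mark * *** by (metis mark.exhaust surj_pair)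
  next
    case (Edge_Mark e)
    then show ?thesis using assms(2,3) eq ** *** by (metis mark.exhaust surj_pair)
  qed
qed

section \<open>The composite map\<close>

text \<open>Both lists are strictly increasing under \<open>f\<close> and have the same elements,
  and such a list is determined by its elements.\<close>

lemma rev_map_antitone:
  fixes f :: "'a \<Rightarrow> 'b :: linorder"
  assumes sorted: "sorted_wrt (\<lambda>x y. f x < f y) xs" and img: "\<iota> ` set xs = set xs"
    and anti: "\<And>x y. \<lbrakk>x \<in> set xs; y \<in> set xs; f x < f y\<rbrakk> \<Longrightarrow> f (\<iota> y) < f (\<iota> x)"
  shows "rev (map \<iota> xs) = xs"
proof -
  have "sorted_wrt (\<lambda>x y. f (\<iota> y) < f (\<iota> x)) xs"
    by (rule sorted_wrt_mono_rel[OF _ sorted]) (rule anti)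
  then have "sorted_wrt (<) (map f (rev (map \<iota> xs)))"
    by (simp add: sorted_wrt_map sorted_wrt_rev rev_map)
  moreover have s: "sorted_wrt (<) (map f xs)"
    using sorted by (simp add: sorted_wrt_map)
  moreover have "set (map f (rev (map \<iota> xs))) = set (map f xs)"
    by (simp only: set_map set_rev img)
  ultimately have "map f (rev (map \<iota> xs)) = map f xs"
    using strict_sorted_equal by blast
  moreover have "inj_on f (set (rev (map \<iota> xs)) \<union> set xs)"
    using s img by (simp add: strict_sorted_iff distinct_map)
  ultimately show ?thesis by (rule map_inj_on)
qed

text \<open>
  An involution of \<open>X\<close> that reverses the order of the maxima exchanges \<open>A\<^sub>i\<close> and
  \<open>A\<^bsub>k+1-i\<^esub>\<close>, so indices disappear from \<open>phi_B\<close>.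
\<close>

lemma phi_B_involution:
  assumes fin: "finite X" "disjoint X" "\<And>A. A \<in> X \<Longrightarrow> finite A \<and> A \<noteq> {}"
    and closed: "\<And>A. A \<in> X \<Longrightarrow> \<iota> A \<in> X" and inv: "\<And>A. A \<in> X \<Longrightarrow> \<iota> (\<iota> A) = A"
    and anti: "\<And>A A'. \<lbrakk>A \<in> X; A' \<in> X; Max A < Max A'\<rbrakk> \<Longrightarrow> Max (\<iota> A') < Max (\<iota> A)"
  shows "fst (phi_B (\<sigma>, X)) = (\<sigma> - {A \<in> X. \<iota> A \<noteq> A}) \<union> {A \<union> \<iota> A |A. A \<in> X \<and> \<iota> A \<noteq> A}"
    and "(X = {} \<and> snd (phi_B (\<sigma>, X)) = No_Mark) \<or>
      (\<exists>A\<in>X. \<iota> A = A \<and> snd (phi_B (\<sigma>, X)) = Block_Mark A) \<or>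
      ((\<forall>A\<in>X. \<iota> A \<noteq> A) \<and> (\<exists>A\<in>X. Max A < Max (\<iota> A) \<and>
         snd (phi_B (\<sigma>, X)) = Edge_Mark (Max A, Min (\<iota> A)) \<and>
         (\<forall>C\<in>X. Max C < Max (\<iota> C) \<longrightarrow> Max C \<le> Max A)))"
proof -
  define xs where "xs = sorted_key_list_of_set Max X"
  define k where "k = card X"
  define t where "t = k div 2"
  have set: "set xs = X" and sorted: "sorted_wrt (\<lambda>A B. Max A < Max B) xs"
    unfolding xs_def using sorted_key_list_of_set_Max[OF fin] by auto
  have img: "\<iota> ` X = X"
    using closed inv by (metis image_iff subsetI subset_antisym image_subsetI)
  have rev: "rev (map \<iota> xs) = xs"
    by (rule rev_map_antitone[OF sorted]) (use set img anti in auto)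
  have dist: "distinct xs"
  proof -
    have "sorted_wrt (<) (map Max xs)" using sorted by (simp add: sorted_wrt_map)
    then show ?thesis by (simp add: strict_sorted_iff distinct_map)
  qed
  have len: "length xs = k"
    using distinct_card[OF dist] set by (simp add: k_def)
  \<comment> \<open>List indices start at 0: the \<open>i\<close>-th block is entry
    \<open>i - 1\<close>, and block \<open>k + 1 - i\<close> is entry
    \<open>k - 1 - (i - 1)\<close>.\<close>
  have iota: "\<iota> (xs ! j) = xs ! (k - 1 - j)" if "j < k" for j
  proof -
    have "xs ! (k - 1 - j) = rev (map \<iota> xs) ! (k - 1 - j)" using rev by simp
    also have "\<dots> = \<iota> (xs ! j)" using that len by (simp add: rev_nth)
    finally show ?thesis ..
  qed
  have mem: "xs ! j \<in> X" if "j < k" for j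
    using that len set nth_mem by metis
  have idx: "\<exists>j<k. A = xs ! j" if "A \<in> X" for A
    using that len set by (metis in_set_conv_nth)
  have inj: "xs ! i = xs ! j \<longleftrightarrow> i = j" if "i < k" "j < k" for i j
    using that dist len by (simp add: nth_eq_iff_index_eq)
  have mono: "Max (xs ! i) < Max (xs ! j) \<longleftrightarrow> i < j" if "i < k" "j < k" for i j
  proof -
    have *: "Max (xs ! i) < Max (xs ! j)" if "i < j" "j < k" for i j
      using sorted_wrt_nth_less[OF sorted] that len by simp
    show ?thesis using *[of i j] *[of j i] that by (cases i j rule: linorder_cases) auto
  qed
  have fix_iff: "\<iota> (xs ! j) = xs ! j \<longleftrightarrow> k - 1 - j = j" if "j < k" for j
    using that iota[OF that] inj[of "k - 1 - j" j] by simp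
  have A1: "nth_block X i = xs ! (i - 1)" "nth_block X (k + 1 - i) = \<iota> (xs ! (i - 1))"
    if "i \<in> {1..t}" for i
  proof -
    show "nth_block X i = xs ! (i - 1)" by (simp add: nth_block_def xs_def)
    have "i - 1 < k" "k - 1 - (i - 1) = k + 1 - i - 1" using that by (auto simp: t_def)
    then show "nth_block X (k + 1 - i) = \<iota> (xs ! (i - 1))"
      using iota by (simp add: nth_block_def xs_def)
  qed
  have moved: "xs ! j \<in> X \<and> \<iota> (xs ! j) \<noteq> xs ! j" if "j < t" for j
    using that mem[of j] fix_iff[of j] by (auto simp: t_def)
  \<comment> \<open>The indices \<open>j\<close> and \<open>k - 1 - j\<close> add up to
    \<open>k - 1\<close>. If they differ, the smaller one is below
    \<open>t = k div 2\<close>.\<close>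
  have half: "\<exists>j<t. A = xs ! j \<or> A = \<iota> (xs ! j)" if A: "A \<in> X" "\<iota> A \<noteq> A" for A
  proof -
    obtain j where j: "j < k" "A = xs ! j" using idx[OF A(1)] by blast
    have "k - 1 - j \<noteq> j" using fix_iff[OF j(1)] A j by simp
    then have "j < t \<or> k - 1 - j < t" using j(1) unfolding t_def by arith
    then consider "j < t" | "k - 1 - j < t" by blast
    then show ?thesis
    proof cases
      case 1
      then show ?thesis using j by blast
    next
      case 2
      moreover have "A = \<iota> (xs ! (k - 1 - j))"
        using iota[OF j(1)] inv[OF A(1)] j(2) by simp
      ultimately show ?thesis by blast
    qed
  qed
  have R: "(\<Union>i\<in>{1..t}. {nth_block X i, nth_block X (k + 1 - i)}) = (\<Union>j<t. {xs ! j, \<iota> (xs ! j)})"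
  proof -
    have "(\<Union>i\<in>{1..t}. {nth_block X i, nth_block X (k + 1 - i)}) =
      (\<Union>i\<in>Suc ` {..<t}. {nth_block X i, nth_block X (k + 1 - i)})"
      by (simp add: image_Suc_lessThan)
    also have "\<dots> = (\<Union>j<t. {xs ! j, \<iota> (xs ! j)})"
      unfolding UN_simps(10) using A1[of "Suc _"] by (intro SUP_cong refl) auto
    finally show ?thesis .
  qed
  have "(\<lambda>i. nth_block X i \<union> nth_block X (k + 1 - i)) ` {1..t} =
      (\<lambda>i. nth_block X i \<union> nth_block X (k + 1 - i)) ` Suc ` {..<t}"
    by (simp add: image_Suc_lessThan)
  also have "\<dots> = (\<lambda>j. xs ! j \<union> \<iota> (xs ! j)) ` {..<t}"
    unfolding image_image using A1[of "Suc _"] by (intro image_cong refl) auto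
  finally have U: "(\<lambda>i. nth_block X i \<union> nth_block X (k + 1 - i)) ` {1..t} =
    (\<lambda>j. xs ! j \<union> \<iota> (xs ! j)) ` {..<t}" .
  have R': "(\<Union>j<t. {xs ! j, \<iota> (xs ! j)}) = {A \<in> X. \<iota> A \<noteq> A}"
  proof (intro equalityI subsetI)
    fix A assume "A \<in> (\<Union>j<t. {xs ! j, \<iota> (xs ! j)})"
    then obtain j where j: "j < t" "A = xs ! j \<or> A = \<iota> (xs ! j)" by blast
    then show "A \<in> {A \<in> X. \<iota> A \<noteq> A}" using moved[OF j(1)] closed inv by auto
  next
    fix A assume "A \<in> {A \<in> X. \<iota> A \<noteq> A}"
    then show "A \<in> (\<Union>j<t. {xs ! j, \<iota> (xs ! j)})" using half[of A] by blast
  qed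
  have U': "(\<lambda>j. xs ! j \<union> \<iota> (xs ! j)) ` {..<t} = {A \<union> \<iota> A |A. A \<in> X \<and> \<iota> A \<noteq> A}"
  proof (intro equalityI subsetI)
    fix S assume "S \<in> (\<lambda>j. xs ! j \<union> \<iota> (xs ! j)) ` {..<t}"
    then show "S \<in> {A \<union> \<iota> A |A. A \<in> X \<and> \<iota> A \<noteq> A}" using moved by blast
  next
    fix S assume "S \<in> {A \<union> \<iota> A |A. A \<in> X \<and> \<iota> A \<noteq> A}"
    then obtain A where A: "A \<in> X" "\<iota> A \<noteq> A" "S = A \<union> \<iota> A" by blast
    obtain j where j: "j < t" "A = xs ! j \<or> A = \<iota> (xs ! j)" using half[OF A(1,2)] by blast
    then have "S = xs ! j \<union> \<iota> (xs ! j)" using A(3) moved[OF j(1)] inv by auto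
    then show "S \<in> (\<lambda>j. xs ! j \<union> \<iota> (xs ! j)) ` {..<t}" using j(1) by blast
  qed
  show "fst (phi_B (\<sigma>, X)) = (\<sigma> - {A \<in> X. \<iota> A \<noteq> A}) \<union> {A \<union> \<iota> A |A. A \<in> X \<and> \<iota> A \<noteq> A}"
    unfolding phi_B_def Let_def prod.case fst_conv
    using R R' U U' by (simp only: k_def t_def)
  have snd: "snd (phi_B (\<sigma>, X)) = (if k = 0 then No_Mark
    else if even k then Edge_Mark (Max (xs ! (t - 1)), Min (xs ! t))
    else Block_Mark (xs ! t))"
    by (simp add: phi_B_def Let_def nth_block_def k_def t_def xs_def)
  show "(X = {} \<and> snd (phi_B (\<sigma>, X)) = No_Mark) \<or>
      (\<exists>A\<in>X. \<iota> A = A \<and> snd (phi_B (\<sigma>, X)) = Block_Mark A) \<or>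
      ((\<forall>A\<in>X. \<iota> A \<noteq> A) \<and> (\<exists>A\<in>X. Max A < Max (\<iota> A) \<and>
         snd (phi_B (\<sigma>, X)) = Edge_Mark (Max A, Min (\<iota> A)) \<and>
         (\<forall>C\<in>X. Max C < Max (\<iota> C) \<longrightarrow> Max C \<le> Max A)))"
  proof (cases "k = 0")
    case True
    then show ?thesis using snd fin(1) by (simp add: k_def)
  next
    case k0: False
    show ?thesis
    proof (cases "even k")
      case True
      then have k: "k = 2 * t" "0 < t" using k0 by (auto simp: t_def)
      have "\<forall>A\<in>X. \<iota> A \<noteq> A"
      proof
        fix A assume "A \<in> X"
        then obtain j where j: "j < k" "A = xs ! j" using idx by blast
        have "k - 1 - j \<noteq> j" using j k by presburger
        then show "\<iota> A \<noteq> A" using fix_iff[OF j(1)] j(2) by simp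
      qed
      moreover have it: "\<iota> (xs ! (t - 1)) = xs ! t"
        using iota[of "t - 1"] k by simp
      moreover have "Max (xs ! (t - 1)) < Max (xs ! t)"
        using mono[of "t - 1" t] k by simp
      moreover have "Max C \<le> Max (xs ! (t - 1))" if C: "C \<in> X" "Max C < Max (\<iota> C)" for C
      proof -
        obtain j where j: "j < k" "C = xs ! j" using idx[OF C(1)] by blast
        \<comment> \<open>\<open>C\<close> precedes its mirror image, so it lies in the first half
          of the list, which ends at index \<open>t - 1\<close>.\<close>
        have "j < k - 1 - j" using C(2) mono[of j "k - 1 - j"] iota[OF j(1)] j by simp
        then have "\<not> t - 1 < j" using k by linarith
        then show ?thesis using mono[of "t - 1" j] j k by (simp add: not_less)
      qed
      moreover have "xs ! (t - 1) \<in> X" using mem k by simp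
      moreover have "snd (phi_B (\<sigma>, X)) = Edge_Mark (Max (xs ! (t - 1)), Min (xs ! t))"
        using snd k0 True by simp
      ultimately show ?thesis
        by (intro disjI2 conjI bexI[of _ "xs ! (t - 1)"]) simp_all
    next
      case False
      then have k: "k = 2 * t + 1" by (simp add: t_def)
      then have "\<iota> (xs ! t) = xs ! t" "xs ! t \<in> X"
        using fix_iff[of t] mem[of t] by auto
      moreover have "snd (phi_B (\<sigma>, X)) = Block_Mark (xs ! t)"
        using snd k0 False by simp
      ultimately show ?thesis by blast
    qed
  qed
qed

section \<open>Positive parts and the involution induced by negation\<close>

definition abs_blocks :: "int set set \<Rightarrow> int set set" where
  "abs_blocks \<pi> = (\<lambda>B. abs ` B) ` \<pi>"

text \<open>For \<open>A = pos_part B\<close> nonempty this is \<open>pos_part (neg_set B)\<close>.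
  It is expressed through \<open>A\<close> instead of \<open>B\<close> because
  \<open>phi_B_involution\<close> asks for a map on the blocks in \<open>X\<close>.\<close>

definition partner :: "int set set \<Rightarrow> int set \<Rightarrow> int set" where
  "partner \<pi> A = {b. 0 < b \<and> (\<exists>B\<in>\<pi>. A \<subseteq> B \<and> - b \<in> B)}"

text \<open>This is the set \<open>X\<close> produced by \<open>phi_NC_B\<close>, in a form that is
  visibly closed under exchanging \<open>B\<close> and \<open>neg_set B\<close>.\<close>

definition split_parts :: "int set set \<Rightarrow> int set set" where
  "split_parts \<pi> = {pos_part B |B. B \<in> \<pi> \<and> pos_part B \<noteq> {} \<and> pos_part (neg_set B) \<noteq> {}}"

lemma pos_part_iff:
  assumes "partition_B n \<pi>" "B \<in> \<pi>"
  shows "x \<in> pos_part B \<longleftrightarrow> x \<in> B \<and> 0 < x"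
  using partition_B_elem[OF assms, of x] by (auto simp: pos_part_def)

lemma abs_image_iff:
  fixes B :: "int set"
  shows "x \<in> abs ` B \<longleftrightarrow> 0 \<le> x \<and> (x \<in> B \<or> - x \<in> B)"
proof -
  have "x \<in> abs ` B" if "0 \<le> x" "x \<in> B" using that by (force simp: image_iff)
  moreover have "x \<in> abs ` B" if "0 \<le> x" "- x \<in> B" using that by (force simp: image_iff)
  ultimately show ?thesis by (auto simp: abs_if)
qed

lemma abs_image_neg_set: "abs ` neg_set B = abs ` B"
  by (simp only: set_eq_iff abs_image_iff mem_neg_set minus_minus) blast

lemma abs_image_eq_parts: "abs ` B = pos_part B \<union> pos_part (neg_set B)"
  by (simp only: set_eq_iff abs_image_iff pos_part_def Un_iff mem_Collect_eq mem_neg_set not_less) blast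

text \<open>By disjointness the only block that can contain a nonempty \<open>pos_part B\<close> is
  \<open>B\<close>, and the containment is proper exactly if \<open>B\<close> has a negative
  element.\<close>

lemma phi_NC_B_eq:
  assumes p: "partition_B n \<pi>"
  shows "phi_NC_B \<pi> = ({pos_part B |B. B \<in> \<pi> \<and> pos_part B \<noteq> {}}, split_parts \<pi>)"
proof -
  have D: "delete_negatives \<pi> = {pos_part B |B. B \<in> \<pi> \<and> pos_part B \<noteq> {}}"
  proof -
    have "delete_negatives \<pi> = pos_part ` \<pi> - {{}}"
      by (simp add: delete_negatives_def pos_part_def[abs_def])
    then show ?thesis by auto
  qed
  have sub: "pos_part B \<subset> B \<longleftrightarrow> pos_part (neg_set B) \<noteq> {}" if "B \<in> \<pi>" for B
  proof -
    have "pos_part B \<subset> B \<longleftrightarrow> (\<exists>x. x \<in> B \<and> x < 0)"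
      by (auto simp: pos_part_def psubset_eq)
    also have "\<dots> \<longleftrightarrow> (\<exists>x. - x \<in> B \<and> - x < 0)"
    proof (intro iffI; elim exE)
      show "\<exists>x. - x \<in> B \<and> - x < 0" if "x \<in> B \<and> x < 0" for x
        using that by (intro exI[of _ "- x"]) simp
    qed (rule exI)
    also have "\<dots> \<longleftrightarrow> (\<exists>x. x \<in> pos_part (neg_set B))"
      by (simp add: pos_part_iff[OF p partition_B_neg[OF p that]])
    finally have "pos_part B \<subset> B \<longleftrightarrow> (\<exists>x. x \<in> pos_part (neg_set B))" .
    then show ?thesis by (simp add: ex_in_conv)
  qed
  have iff: "(\<exists>C\<in>\<pi>. pos_part B \<subset> C) \<longleftrightarrow> pos_part (neg_set B) \<noteq> {}"
    if B: "B \<in> \<pi>" "pos_part B \<noteq> {}" for B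
  proof
    assume "\<exists>C\<in>\<pi>. pos_part B \<subset> C"
    then obtain C where C: "C \<in> \<pi>" "pos_part B \<subset> C" by blast
    obtain x where x: "x \<in> pos_part B" using B by blast
    then have "x \<in> B" "x \<in> C" using C by (auto simp: pos_part_def)
    then have "C = B" using partition_B_unique[OF p C(1) B(1)] by blast
    then show "pos_part (neg_set B) \<noteq> {}" using C(2) sub[OF B(1)] by simp
  next
    assume "pos_part (neg_set B) \<noteq> {}"
    then have "pos_part B \<subset> B" using sub[OF B(1)] by simp
    then show "\<exists>C\<in>\<pi>. pos_part B \<subset> C" using B(1) by (rule bexI)
  qed
  have "{A \<in> delete_negatives \<pi>. \<exists>B\<in>\<pi>. A \<subset> B} = split_parts \<pi>"
  proof (intro equalityI subsetI)
    fix A assume "A \<in> {A \<in> delete_negatives \<pi>. \<exists>B\<in>\<pi>. A \<subset> B}"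
    then have A: "A \<in> {pos_part B |B. B \<in> \<pi> \<and> pos_part B \<noteq> {}}" "\<exists>C\<in>\<pi>. A \<subset> C"
      by (simp_all only: D mem_Collect_eq)
    from A(1) obtain B where B: "A = pos_part B" "B \<in> \<pi>" "pos_part B \<noteq> {}" by blast
    then show "A \<in> split_parts \<pi>"
      using iff[OF B(2,3)] A(2) unfolding split_parts_def by (intro CollectI exI[of _ B]) simp
  next
    fix A assume "A \<in> split_parts \<pi>"
    then obtain B where B: "A = pos_part B" "B \<in> \<pi>" "pos_part B \<noteq> {}" "pos_part (neg_set B) \<noteq> {}"
      unfolding split_parts_def by blast
    have "A \<in> delete_negatives \<pi>" unfolding D using B(1-3) by blast
    then show "A \<in> {A \<in> delete_negatives \<pi>. \<exists>B\<in>\<pi>. A \<subset> B}"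
      using iff[OF B(2,3)] B(1,4) by simp
  qed
  then show ?thesis unfolding phi_NC_B_def D by simp
qed

lemma partner_pos_part:
  assumes p: "partition_B n \<pi>" and B: "B \<in> \<pi>" "pos_part B \<noteq> {}"
  shows "partner \<pi> (pos_part B) = pos_part (neg_set B)"
proof -
  have "C = B" if "C \<in> \<pi>" "pos_part B \<subseteq> C" for C
  proof -
    obtain x where x: "x \<in> pos_part B" using B by blast
    then have "x \<in> B" "x \<in> C" using that by (auto simp: pos_part_def)
    then show ?thesis using partition_B_unique[OF p that(1) B(1)] by blast
  qed
  moreover have "pos_part B \<subseteq> B" by (auto simp: pos_part_def)
  ultimately have "(\<exists>C\<in>\<pi>. pos_part B \<subseteq> C \<and> - b \<in> C) \<longleftrightarrow> - b \<in> B" for b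
    using B(1) by blast
  then show ?thesis
    unfolding partner_def by (simp add: set_eq_iff pos_part_iff[OF p partition_B_neg[OF p B(1)]] conj_commute)
qed

text \<open>The positions are \<open>a\<close>, \<open>c\<close>, \<open>n + b\<close>,
  \<open>n + d\<close>. If \<open>a < c\<close> and \<open>b < d\<close>, they alternate between
  \<open>B\<close> and \<open>C\<close>, and likewise with the roles exchanged. So the chords from
  \<open>a\<close> to \<open>- b\<close> and from \<open>c\<close> to \<open>- d\<close> must be
  nested.\<close>

lemma split_blocks_antitone:
  assumes nc: "\<pi> \<in> NC_B n" and B: "B \<in> \<pi>" and C: "C \<in> \<pi>" and "B \<noteq> C"
    and mem: "a \<in> B" "- b \<in> B" "c \<in> C" "- d \<in> C" and pos: "0 < a" "0 < b" "0 < c" "0 < d"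
  shows "a < c \<longleftrightarrow> d < b"
proof -
  note p = NC_B_partition[OF nc]
  have ne: "a \<noteq> c" "d \<noteq> b"
    using partition_B_unique[OF p B C] \<open>B \<noteq> C\<close> mem by auto
  have bd: "a \<le> int n" "b \<le> int n" "c \<le> int n" "d \<le> int n"
    using partition_B_elem[OF p B mem(1)] partition_B_elem[OF p B mem(2)]
      partition_B_elem[OF p C mem(3)] partition_B_elem[OF p C mem(4)] by auto
  have "\<not> (a < c \<and> b < d)"
    using NC_B_noncrossing[OF nc B C mem] pos bd \<open>B \<noteq> C\<close> by (auto simp: cpos_def)
  moreover have "\<not> (c < a \<and> d < b)"
    using NC_B_noncrossing[OF nc C B mem(3,4,1,2)] pos bd \<open>B \<noteq> C\<close> by (auto simp: cpos_def)
  ultimately show ?thesis using ne by linarith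
qed

lemma split_partsE:
  assumes "partition_B n \<pi>" "A \<in> split_parts \<pi>"
  obtains B where "B \<in> \<pi>" "A = pos_part B" "partner \<pi> A = pos_part (neg_set B)"
    "A \<noteq> {}" "partner \<pi> A \<noteq> {}" "finite A" "finite (partner \<pi> A)"
proof -
  obtain B where B: "B \<in> \<pi>" "A = pos_part B" "pos_part B \<noteq> {}" "pos_part (neg_set B) \<noteq> {}"
    using assms(2) unfolding split_parts_def by blast
  moreover have "finite (pos_part C)" if "C \<in> \<pi>" for C
    using partition_B_finite_block[OF assms(1) that] by (simp add: pos_part_def)
  then have "finite (pos_part B)" "finite (pos_part (neg_set B))"
    using partition_B_neg[OF assms(1) B(1)] B(1) by blast+
  ultimately show thesis
    using that[of B] partner_pos_part[OF assms(1) B(1,3)] by simp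
qed

lemma split_partsI:
  assumes "partition_B n \<pi>" "B \<in> \<pi>" "c \<in> B" "- d \<in> B" "0 < c" "0 < d"
  shows "pos_part B \<in> split_parts \<pi>"
proof -
  have "c \<in> pos_part B" "d \<in> pos_part (neg_set B)" using assms(3-6) by (auto simp: pos_part_def)
  then show ?thesis unfolding split_parts_def using assms(2) by blast
qed

lemma partner_closed:
  assumes p: "partition_B n \<pi>" and "A \<in> split_parts \<pi>"
  shows "partner \<pi> A \<in> split_parts \<pi>" "partner \<pi> (partner \<pi> A) = A"
proof -
  obtain B where B: "B \<in> \<pi>" "A = pos_part B" "partner \<pi> A = pos_part (neg_set B)"
    "A \<noteq> {}" "partner \<pi> A \<noteq> {}" using split_partsE[OF assms] by metis
  note n = partition_B_neg[OF p B(1)]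
  show "partner \<pi> A \<in> split_parts \<pi>"
    unfolding split_parts_def using B n by (intro CollectI exI[of _ "neg_set B"]) simp
  show "partner \<pi> (partner \<pi> A) = A"
    using partner_pos_part[OF p n] B by simp
qed

text \<open>With \<open>b\<close> and \<open>d\<close> held fixed,
  \<open>split_blocks_antitone\<close> decides every comparison between \<open>A\<close> and
  \<open>A'\<close> by the same condition \<open>d < b\<close>. The two parts are thus separated as
  wholes, and comparing maxima compares all elements.\<close>

lemma split_parts_ordered:
  assumes nc: "\<pi> \<in> NC_B n" and A: "A \<in> split_parts \<pi>" "A' \<in> split_parts \<pi>" "Max A < Max A'"
    and mem: "a \<in> A" "a' \<in> A'"
  shows "a < a'"
proof -
  note p = NC_B_partition[OF nc]
  obtain B where B: "B \<in> \<pi>" "A = pos_part B" "partner \<pi> A = pos_part (neg_set B)"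
    "partner \<pi> A \<noteq> {}" "finite A" using split_partsE[OF p A(1)] by metis
  obtain C where C: "C \<in> \<pi>" "A' = pos_part C" "partner \<pi> A' = pos_part (neg_set C)"
    "partner \<pi> A' \<noteq> {}" "finite A'" using split_partsE[OF p A(2)] by metis
  obtain b d where bd: "b \<in> pos_part (neg_set B)" "d \<in> pos_part (neg_set C)" using B C by auto
  have "B \<noteq> C" using A(3) B(2) C(2) by auto
  note it = pos_part_iff[OF p B(1)] pos_part_iff[OF p C(1)]
    pos_part_iff[OF p partition_B_neg[OF p B(1)]] pos_part_iff[OF p partition_B_neg[OF p C(1)]]
  have key: "x < y \<longleftrightarrow> d < b" if "x \<in> A" "y \<in> A'" for x y
    by (rule split_blocks_antitone[OF nc B(1) C(1) \<open>B \<noteq> C\<close>]) (use that bd B(2) C(2) it in auto)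
  have "Max A \<in> A" "Max A' \<in> A'" using mem B(5) C(5) by (auto intro!: Max_in)
  then show ?thesis using key mem A(3) by blast
qed

lemma partner_antitone:
  assumes nc: "\<pi> \<in> NC_B n" and A: "A \<in> split_parts \<pi>" "A' \<in> split_parts \<pi>" "Max A < Max A'"
  shows "Max (partner \<pi> A') < Max (partner \<pi> A)"
proof -
  note p = NC_B_partition[OF nc]
  obtain B where B: "B \<in> \<pi>" "A = pos_part B" "partner \<pi> A = pos_part (neg_set B)"
    "A \<noteq> {}" "partner \<pi> A \<noteq> {}" "finite A" "finite (partner \<pi> A)"
    using split_partsE[OF p A(1)] by metis
  obtain C where C: "C \<in> \<pi>" "A' = pos_part C" "partner \<pi> A' = pos_part (neg_set C)"
    "A' \<noteq> {}" "partner \<pi> A' \<noteq> {}" "finite A'" "finite (partner \<pi> A')"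
    using split_partsE[OF p A(2)] by metis
  have "B \<noteq> C" using A(3) B(2) C(2) by auto
  note it = pos_part_iff[OF p B(1)] pos_part_iff[OF p C(1)]
    pos_part_iff[OF p partition_B_neg[OF p B(1)]] pos_part_iff[OF p partition_B_neg[OF p C(1)]]
  have "Max A \<in> A" "Max A' \<in> A'" "Max (partner \<pi> A) \<in> partner \<pi> A"
    "Max (partner \<pi> A') \<in> partner \<pi> A'"
    using B C by (auto intro!: Max_in simp del: B(2,3) C(2,3))
  then have "Max A < Max A' \<longleftrightarrow> Max (partner \<pi> A') < Max (partner \<pi> A)"
    unfolding B(3) C(3)
    by (intro split_blocks_antitone[OF nc B(1) C(1) \<open>B \<noteq> C\<close>]) (simp_all add: B(2) C(2) it)
  then show ?thesis using A(3) by blast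
qed

lemma split_parts_regular:
  assumes p: "partition_B n \<pi>"
  shows "finite (split_parts \<pi>)" "disjoint (split_parts \<pi>)"
    "\<And>A. A \<in> split_parts \<pi> \<Longrightarrow> finite A \<and> A \<noteq> {}"
proof -
  have "split_parts \<pi> \<subseteq> pos_part ` \<pi>" unfolding split_parts_def by auto
  then show "finite (split_parts \<pi>)" using partition_B_finite[OF p] finite_surj by blast
  show "finite A \<and> A \<noteq> {}" if "A \<in> split_parts \<pi>" for A
    using split_partsE[OF p that] by metis
  show "disjoint (split_parts \<pi>)"
  proof (rule disjointI)
    fix A A' assume A: "A \<in> split_parts \<pi>" "A' \<in> split_parts \<pi>" "A \<noteq> A'"
    obtain B where B: "B \<in> \<pi>" "A = pos_part B" using split_partsE[OF p A(1)] by metis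
    obtain C where C: "C \<in> \<pi>" "A' = pos_part C" using split_partsE[OF p A(2)] by metis
    have "B \<noteq> C" using A(3) B C by auto
    then have "x \<in> B \<Longrightarrow> x \<in> C \<Longrightarrow> False" for x
      using partition_B_unique[OF p B(1) C(1)] by blast
    then show "A \<inter> A' = {}" using B(2) C(2) by (auto simp: pos_part_def)
  qed
qed

lemma split_parts_Max_eq:
  assumes p: "partition_B n \<pi>" and A: "A \<in> split_parts \<pi>" "A' \<in> split_parts \<pi>"
    and "Max A = Max A'"
  shows "A = A'"
proof (rule ccontr)
  assume "A \<noteq> A'"
  moreover have "Max A \<in> A" "Max A \<in> A'"
    using split_parts_regular(3)[OF p] A Max_in assms(4) by metis+
  ultimately show False
    using disjointD[OF split_parts_regular(2)[OF p] A] by blast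
qed

text \<open>The absolute values of \<open>B\<close> are \<open>pos_part B\<close> together with its
  partner. The two coincide for the zero block, the partner is empty for an all-positive block, and
  in the remaining case \<open>phi_B\<close> joins them.\<close>

lemma fst_psi_B:
  assumes nc: "\<pi> \<in> NC_B n"
  shows "fst (psi_B \<pi>) = abs_blocks \<pi>"
proof -
  note p = NC_B_partition[OF nc]
  let ?X = "split_parts \<pi>" and ?\<iota> = "partner \<pi>"
  let ?D = "{pos_part B |B. B \<in> \<pi> \<and> pos_part B \<noteq> {}}"
  have "fst (psi_B \<pi>) = (?D - {A \<in> ?X. ?\<iota> A \<noteq> A}) \<union> {A \<union> ?\<iota> A |A. A \<in> ?X \<and> ?\<iota> A \<noteq> A}"
    unfolding psi_B_def comp_apply phi_NC_B_eq[OF p]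
    by (rule phi_B_involution(1)[OF split_parts_regular[OF p] partner_closed[OF p] partner_antitone[OF nc]])
  also have "\<dots> = abs_blocks \<pi>"
  proof (intro equalityI subsetI)
    fix S assume "S \<in> (?D - {A \<in> ?X. ?\<iota> A \<noteq> A}) \<union> {A \<union> ?\<iota> A |A. A \<in> ?X \<and> ?\<iota> A \<noteq> A}"
    then consider "S \<in> ?D" "\<not> (S \<in> ?X \<and> ?\<iota> S \<noteq> S)" | A where "A \<in> ?X" "S = A \<union> ?\<iota> A" by auto
    then show "S \<in> abs_blocks \<pi>"
    proof cases
      case 1
      then obtain B where B: "S = pos_part B" "B \<in> \<pi>" "pos_part B \<noteq> {}" by auto
      \<comment> \<open>A block that \<open>phi_B\<close> leaves alone comes either from a block
        without negative elements or from the zero block.\<close>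
      have "pos_part (neg_set B) = {} \<or> pos_part (neg_set B) = S"
      proof (cases "pos_part (neg_set B) = {}")
        case False
        then have "S \<in> ?X" using B unfolding split_parts_def by auto
        then show ?thesis using 1(2) partner_pos_part[OF p B(2,3)] B(1) by simp
      qed simp
      then have "abs ` B = S" using B(1) abs_image_eq_parts[of B] by auto
      then show ?thesis using B(2) unfolding abs_blocks_def by blast
    next
      case 2
      obtain B where B: "B \<in> \<pi>" "A = pos_part B" "?\<iota> A = pos_part (neg_set B)"
        using split_partsE[OF p 2(1)] by metis
      then have "S = abs ` B" using abs_image_eq_parts[of B] 2(2) by simp
      then show ?thesis using B(1) unfolding abs_blocks_def by blast
    qed
  next
    fix S assume "S \<in> abs_blocks \<pi>"
    then obtain B0 where B0: "B0 \<in> \<pi>" "S = abs ` B0" unfolding abs_blocks_def by blast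
    \<comment> \<open>An all-negative block leaves no trace in
      \<open>delete_negatives \<pi>\<close>; its negative represents the same
      \<open>S\<close>.\<close>
    obtain B where B: "B \<in> \<pi>" "S = abs ` B" "pos_part B \<noteq> {}"
    proof (cases "pos_part B0 = {}")
      case True
      have "abs ` B0 \<noteq> {}" using partition_B_nonempty[OF p B0(1)] by simp
      then have "pos_part (neg_set B0) \<noteq> {}" using True abs_image_eq_parts[of B0] by simp
      then show thesis
        using that[of "neg_set B0"] partition_B_neg[OF p B0(1)] B0(2) by (simp add: abs_image_neg_set)
    next
      case False
      then show thesis using that B0 by blast
    qed
    let ?p = "pos_part B" and ?q = "pos_part (neg_set B)"
    have \<iota>: "?\<iota> ?p = ?q" by (rule partner_pos_part[OF p B(1,3)])
    have S: "S = ?p \<union> ?q" using B(2) abs_image_eq_parts[of B] by simp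
    have D: "?p \<in> ?D" using B by blast
    show "S \<in> (?D - {A \<in> ?X. ?\<iota> A \<noteq> A}) \<union> {A \<union> ?\<iota> A |A. A \<in> ?X \<and> ?\<iota> A \<noteq> A}"
    proof (cases "?q = {}")
      case True
      have "?p \<notin> ?X"
      proof
        assume "?p \<in> ?X"
        then obtain C where "partner \<pi> ?p \<noteq> {}" using split_partsE[OF p] by metis
        then show False using \<iota> True by simp
      qed
      then show ?thesis using S True D by simp
    next
      case False
      then have X: "?p \<in> ?X" using B unfolding split_parts_def by blast
      show ?thesis
      proof (cases "?q = ?p")
        case True
        then have "S = ?p" using S by simp
        then show ?thesis using D \<iota> True by simp
      next
        case False
        then show ?thesis using X S \<iota> by (intro UnI2 CollectI exI[of _ ?p]) simp
      qed
    qed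
  qed
  finally show ?thesis .
qed

text \<open>In the edge case the two middle blocks of the list are the positive parts of some
  \<open>B\<close> and \<open>neg_set B\<close>, so \<open>Max A\<close> and
  \<open>Min (partner \<pi> A)\<close> come from one block. They are innermost because smaller parts
  have larger partners.\<close>

lemma is_mark_snd_psi_B:
  assumes nc: "\<pi> \<in> NC_B n"
  shows "is_mark \<pi> (snd (psi_B \<pi>))"
proof -
  note p = NC_B_partition[OF nc]
  let ?X = "split_parts \<pi>" and ?\<iota> = "partner \<pi>"
  define m where "m = snd (psi_B \<pi>)"
  have "(?X = {} \<and> m = No_Mark) \<or>
      (\<exists>A\<in>?X. ?\<iota> A = A \<and> m = Block_Mark A) \<or>
      ((\<forall>A\<in>?X. ?\<iota> A \<noteq> A) \<and> (\<exists>A\<in>?X. Max A < Max (?\<iota> A) \<and>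
         m = Edge_Mark (Max A, Min (?\<iota> A)) \<and>
         (\<forall>C\<in>?X. Max C < Max (?\<iota> C) \<longrightarrow> Max C \<le> Max A)))"
    unfolding m_def psi_B_def comp_apply phi_NC_B_eq[OF p]
    by (rule phi_B_involution(2)[OF split_parts_regular[OF p] partner_closed[OF p] partner_antitone[OF nc]])
  then consider (none) "?X = {}" "m = No_Mark"
    | (block) A where "A \<in> ?X" "?\<iota> A = A" "m = Block_Mark A"
    | (edge) A where "\<And>C. C \<in> ?X \<Longrightarrow> ?\<iota> C \<noteq> C" "A \<in> ?X" "Max A < Max (?\<iota> A)"
        "m = Edge_Mark (Max A, Min (?\<iota> A))" "\<And>C. C \<in> ?X \<Longrightarrow> Max C < Max (?\<iota> C) \<Longrightarrow> Max C \<le> Max A"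
    by blast
  then have "is_mark \<pi> m"
  proof cases
    case none
    then show ?thesis using split_partsI[OF p] by auto
  next
    case block
    obtain B where B: "B \<in> \<pi>" "A = pos_part B" "?\<iota> A = pos_part (neg_set B)" "A \<noteq> {}"
      using split_partsE[OF p block(1)] by metis
    obtain x where "x \<in> A" using B(4) by blast
    then have "x \<in> B" "- x \<in> B" using B(2,3) block(2) by (auto simp: pos_part_def)
    then have "neg_set B = B" by (rule partition_B_zeroI[OF p B(1)])
    then show ?thesis using B(1,2) block(3) by auto
  next
    case edge
    obtain B where B: "B \<in> \<pi>" "A = pos_part B" "?\<iota> A = pos_part (neg_set B)"
      "A \<noteq> {}" "?\<iota> A \<noteq> {}" "finite A" "finite (?\<iota> A)"
      using split_partsE[OF p edge(2)] by metis
    let ?a = "Max A" and ?b = "Min (?\<iota> A)"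
    have ab: "?a \<in> A" "?b \<in> ?\<iota> A" using Max_in[OF B(6,4)] Min_in[OF B(7,5)] .
    then have abB: "?a \<in> B" "0 < ?a" "- ?b \<in> B"
      using B(1-3) pos_part_iff[OF p B(1)] pos_part_iff[OF p partition_B_neg[OF p B(1)]] by simp_all
    have "?a < ?b"
      by (rule split_parts_ordered[OF nc edge(2) partner_closed(1)[OF p edge(2)] edge(3) ab])
    moreover have "neg_set Z \<noteq> Z" if Z: "Z \<in> \<pi>" for Z
    proof
      assume neg: "neg_set Z = Z"
      obtain z where z: "z \<in> Z" using partition_B_nonempty[OF p Z] by blast
      then have "- z \<in> Z" using neg mem_neg_set[of z Z] by simp
      then have "\<bar>z\<bar> \<in> Z" "- \<bar>z\<bar> \<in> Z" "0 < \<bar>z\<bar>" using z partition_B_elem[OF p Z z] by (auto simp: abs_if)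
      then have "pos_part Z \<in> ?X" "\<bar>z\<bar> \<in> pos_part Z" using split_partsI[OF p Z] by (auto simp: pos_part_def)
      then show False using edge(1) partner_pos_part[OF p Z] neg by auto
    qed
    moreover have "c \<le> ?a \<and> ?b \<le> d"
      if C: "C \<in> \<pi>" "0 < c" "c < d" "c \<in> C" "- d \<in> C" for C c d
    proof -
      let ?C = "pos_part C"
      have X: "?C \<in> ?X" using split_partsI[OF p C(1,4,5)] C(2,3) by simp
      note X' = partner_closed(1)[OF p X]
      have c: "c \<in> ?C" using C by (simp add: pos_part_def)
      then have \<iota>: "?\<iota> ?C = pos_part (neg_set C)" using partner_pos_part[OF p C(1)] by blast
      have d: "d \<in> ?\<iota> ?C" using C unfolding \<iota> by (simp add: pos_part_def)
      have "Max ?C \<noteq> Max (?\<iota> ?C)"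
        using edge(1)[OF X] split_parts_Max_eq[OF p X X'] by metis
      \<comment> \<open>Parts compare as wholes, so the single inequality \<open>c < d\<close>
        already excludes the opposite order.\<close>
      moreover have "\<not> Max (?\<iota> ?C) < Max ?C"
        using split_parts_ordered[OF nc X' X _ d c] C(3) by auto
      ultimately have lt: "Max ?C < Max (?\<iota> ?C)" by simp
      then have le: "Max ?C \<le> ?a" using edge(5)[OF X] by simp
      have fin: "finite ?C" using split_partsE[OF p X] by metis
      have "c \<le> ?a" using Max_ge[OF fin c] le by simp
      moreover have "?b \<le> d"
      proof (cases "?C = A")
        case True
        then show ?thesis using Min_le[OF B(7)] d by simp
      next
        \<comment> \<open>For a different pair of parts \<open>C\<close> lies strictly below
          \<open>A\<close>, so its partner lies strictly above that of \<open>A\<close>.\<close>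
        case False
        then have "Max ?C < Max A" using le split_parts_Max_eq[OF p X edge(2)] by auto
        then have "Max (?\<iota> A) < Max (?\<iota> ?C)" by (rule partner_antitone[OF nc X edge(2)])
        then have "?b < d"
          by (rule split_parts_ordered[OF nc partner_closed(1)[OF p edge(2)] X' _ ab(2) d])
        then show ?thesis by simp
      qed
      ultimately show ?thesis ..
    qed
    ultimately show ?thesis using abB B(1) unfolding edge(4) is_mark.simps by blast
  qed
  then show ?thesis unfolding m_def .
qed

section \<open>The inverse map\<close>

text \<open>
  Every block of \<open>\<pi>\<close> other than the zero block is, up to sign, obtained from
  its image in \<open>\<sigma>\<close> by negating exactly the elements above a threshold that is read off the mark.
  In the cyclic order of \<open>B_seq\<close> the elements of sign pattern \<open>0 < y \<longleftrightarrow> \<bar>y\<bar> \<le> \<theta>\<close> form a half circle.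
\<close>

fun threshold :: "mark \<Rightarrow> int" where
  "threshold No_Mark = 0"
| "threshold (Edge_Mark e) = fst e"
| "threshold (Block_Mark A) = Max A"

definition signed :: "int \<Rightarrow> int set \<Rightarrow> int set" where
  "signed \<theta> S = {y. \<bar>y\<bar> \<in> S \<and> (0 < y \<longleftrightarrow> \<bar>y\<bar> \<le> \<theta>)}"

definition unfold_marked :: "int set set \<times> mark \<Rightarrow> int set set" where
  "unfold_marked = (\<lambda>(\<sigma>, x). \<Union>S\<in>\<sigma>. if x = Block_Mark S then {S \<union> neg_set S}
     else {signed (threshold x) S, neg_set (signed (threshold x) S)})"

lemma neg_set_eq_iff: "neg_set B = C \<longleftrightarrow> B = neg_set C"
  by auto

lemma abs_image_eqD:
  assumes p: "partition_B n \<pi>" and B: "B \<in> \<pi>" and C: "C \<in> \<pi>" and mem: "x \<in> abs ` B" "x \<in> abs ` C"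
  shows "C = B \<or> C = neg_set B"
proof -
  have "(x \<in> B \<or> x \<in> neg_set B) \<and> (x \<in> C \<or> x \<in> neg_set C)"
    using mem unfolding abs_image_iff mem_neg_set by blast
  then consider "C = B" | "C = neg_set B" | "neg_set C = B" | "neg_set C = neg_set B"
    using partition_B_unique[OF p] partition_B_neg[OF p] B C by meson
  then show ?thesis using neg_set_neg_set by metis
qed

lemma zero_block_abs_image:
  assumes p: "partition_B n \<pi>" and B: "B \<in> \<pi>" and "neg_set B = B"
  shows "abs ` B = pos_part B" "B = abs ` B \<union> neg_set (abs ` B)"
proof -
  show 1: "abs ` B = pos_part B" using abs_image_eq_parts[of B] assms(3) by simp
  have m: "y \<in> B \<longleftrightarrow> - y \<in> B" for y using assms(3) mem_neg_set[of y B] by simp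
  show "B = abs ` B \<union> neg_set (abs ` B)"
  proof (rule set_eqI)
    fix y
    show "y \<in> B \<longleftrightarrow> y \<in> abs ` B \<union> neg_set (abs ` B)"
      unfolding 1 using m[of y] partition_B_elem[OF p B, of y] by (auto simp: pos_part_def)
  qed
qed

text \<open>This lets \<open>unfold_marked\<close>, which sees only absolute values, recognise the
  zero block: sets of absolute values determine blocks up to sign, and the zero block is its own
  negative.\<close>

lemma is_mark_zero_block:
  assumes p: "partition_B n \<pi>" and m: "is_mark \<pi> x" and B: "B \<in> \<pi>"
  shows "x = Block_Mark (abs ` B) \<longleftrightarrow> neg_set B = B"
proof
  assume x: "x = Block_Mark (abs ` B)"
  then obtain Z where Z: "Z \<in> \<pi>" "neg_set Z = Z" "abs ` B = pos_part Z" using m by auto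
  then have "abs ` B = abs ` Z" using zero_block_abs_image(1)[OF p] by simp
  moreover obtain y where "y \<in> B" using partition_B_nonempty[OF p B] by blast
  ultimately have "\<bar>y\<bar> \<in> abs ` Z" "\<bar>y\<bar> \<in> abs ` B" by blast+
  then have "B = Z \<or> B = neg_set Z" using abs_image_eqD[OF p Z(1) B] by blast
  then show "neg_set B = B" using Z(2) by auto
next
  assume neg: "neg_set B = B"
  obtain z where z: "z \<in> B" using partition_B_nonempty[OF p B] by blast
  then have "- z \<in> B" using neg mem_neg_set[of z B] by simp
  then have "\<bar>z\<bar> \<in> B" "- \<bar>z\<bar> \<in> B" "0 < \<bar>z\<bar>" using z partition_B_elem[OF p B z] by (auto simp: abs_if)
  then have "\<not> is_mark \<pi> No_Mark" using B unfolding is_mark.simps by blast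
  moreover have "\<not> is_mark \<pi> (Edge_Mark e)" for e using B neg by (cases e) auto
  ultimately obtain A where x: "x = Block_Mark A" using m by (cases x) auto
  then obtain Z where Z: "Z \<in> \<pi>" "neg_set Z = Z" "A = pos_part Z" using m by auto
  then have "Z = B" using partition_B_zero[OF p _ B _ neg] by blast
  then show "x = Block_Mark (abs ` B)" using x Z zero_block_abs_image(1)[OF p B neg] by simp
qed

lemma threshold_Block_Mark:
  assumes p: "partition_B n \<pi>" and Z: "Z \<in> \<pi>" "neg_set Z = Z"
  shows "Max (pos_part Z) \<in> Z" "- Max (pos_part Z) \<in> Z" "0 < Max (pos_part Z)"
    "Max (pos_part Z) \<le> int n"
proof -
  have "pos_part Z = abs ` Z" using zero_block_abs_image(1)[OF p Z] by simp
  then have "pos_part Z \<noteq> {}" "finite (pos_part Z)"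
    using partition_B_nonempty[OF p Z(1)] partition_B_finite_block[OF p Z(1)] by simp_all
  then have "Max (pos_part Z) \<in> pos_part Z" by (intro Max_in)
  then show 1: "Max (pos_part Z) \<in> Z" and "0 < Max (pos_part Z)"
    using pos_part_iff[OF p Z(1)] by blast+
  then show "- Max (pos_part Z) \<in> Z" "Max (pos_part Z) \<le> int n"
    using Z(2) mem_neg_set[of "Max (pos_part Z)" Z] partition_B_elem[OF p Z(1) 1] by auto
qed

text \<open>The mark provides a chord that \<open>B\<close> must not cross: from \<open>a\<close> to
  \<open>- b\<close> for an edge mark, and the diameter from the threshold to its negative for a
  block mark. Without a mark no block mixes signs, and threshold 0 separates positives from
  negatives.\<close>

lemma sign_rule_pos:
  assumes nc: "\<pi> \<in> NC_B n" and m: "is_mark \<pi> x" and B: "B \<in> \<pi>" "neg_set B \<noteq> B"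
    and pos: "0 < c" "0 < d"
  shows sign_rule_opp: "\<lbrakk>c \<in> B; - d \<in> B\<rbrakk> \<Longrightarrow> c \<le> threshold x \<longleftrightarrow> \<not> d \<le> threshold x"
    and sign_rule_same: "\<lbrakk>c \<in> B; d \<in> B\<rbrakk> \<Longrightarrow> c \<le> threshold x \<longleftrightarrow> d \<le> threshold x"
proof -
  note p = NC_B_partition[OF nc]
  have nz: "- y \<notin> B" if "y \<in> B" for y using partition_B_zeroI[OF p B(1) that] B(2) by blast
  note bd = partition_B_elem[OF p]
  have "(\<forall>c d. 0 < c \<and> 0 < d \<and> c \<in> B \<and> - d \<in> B \<longrightarrow> (c \<le> threshold x \<longleftrightarrow> \<not> d \<le> threshold x)) \<and>
    (\<forall>c d. 0 < c \<and> c < d \<and> c \<in> B \<and> d \<in> B \<longrightarrow> (c \<le> threshold x \<longleftrightarrow> d \<le> threshold x))"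
  proof (cases x)
    case No_Mark
    then show ?thesis using m B(1) by auto
  next
    case (Edge_Mark e)
    obtain a b where e: "e = (a, b)" by fastforce
    have th: "threshold x = a" using Edge_Mark e by simp
    obtain B0 where B0: "B0 \<in> \<pi>" "a \<in> B0" "- b \<in> B0" and ab: "0 < a" "a < b"
      and inner: "\<And>C c d. \<lbrakk>C \<in> \<pi>; 0 < c; c < d; c \<in> C; - d \<in> C\<rbrakk> \<Longrightarrow> c \<le> a \<and> b \<le> d"
      using m Edge_Mark e by auto
    have opp: "c \<le> a \<longleftrightarrow> \<not> d \<le> a" if "0 < c" "0 < d" "c \<in> B" "- d \<in> B" for c d
    proof (cases c d rule: linorder_cases)
      case less
      then show ?thesis using inner[OF B(1)] that ab by force
    next
      case equal
      then show ?thesis using nz that by blast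
    next
      case greater
      \<comment> \<open>Innermost pairs are stated for \<open>c < d\<close>; the pair
        \<open>c\<close>, \<open>- d\<close> in \<open>B\<close> becomes \<open>d\<close>,
        \<open>- c\<close> in \<open>neg_set B\<close>.\<close>
      then show ?thesis using inner[OF partition_B_neg[OF p B(1)], of d c] that ab by force
    qed
    have same: "c \<le> a \<longleftrightarrow> d \<le> a" if cd: "0 < c" "c < d" "c \<in> B" "d \<in> B" for c d
    proof (rule ccontr)
      assume "\<not> ?thesis"
      then have lt: "c \<le> a" "a < d" using cd(2) by auto
      \<comment> \<open>If \<open>d\<close> and \<open>- b\<close> shared a block,
        \<open>opp\<close> would require one of \<open>d\<close>, \<open>b\<close> to be at most
        \<open>a\<close>, but both exceed it. With \<open>B\<close> and \<open>B0\<close> distinct,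
        the positions \<open>c < a < d < n + b\<close> alternate.\<close>
      have "B \<noteq> B0" using opp[of d b] B0(3) cd lt ab by auto
      moreover have "B \<noteq> neg_set B0" using opp[of c a] B0(2) cd lt ab by auto
      moreover have "c < a" using partition_B_unique[OF p B(1) B0(1) cd(3)] B0(2) \<open>B \<noteq> B0\<close> lt(1)
        by (cases "c = a") auto
      ultimately show False
        using NC_B_noncrossing[OF nc B(1) B0(1) cd(3,4) B0(2,3)] cd lt ab
          bd[OF B(1) cd(4)] by (auto simp: cpos_def)
    qed
    show ?thesis using opp same unfolding th by blast
  next
    case (Block_Mark A)
    then obtain Z where Z: "Z \<in> \<pi>" "neg_set Z = Z" "A = pos_part Z" using m by auto
    define \<theta> where "\<theta> = threshold x"
    have \<theta>: "\<theta> \<in> Z" "- \<theta> \<in> Z" "0 < \<theta>" "\<theta> \<le> int n"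
      unfolding \<theta>_def using Block_Mark Z(3) threshold_Block_Mark[OF p Z(1,2)] by simp_all
    have BZ: "B \<noteq> Z" using B(2) Z(2) by blast
    have ne: "y \<noteq> \<theta>" "y \<noteq> - \<theta>" if "y \<in> B" for y
      using partition_B_unique[OF p B(1) Z(1) that] \<theta> BZ by auto
    have opp: "c \<le> \<theta> \<longleftrightarrow> \<not> d \<le> \<theta>" if cd: "0 < c" "0 < d" "c \<in> B" "- d \<in> B" for c d
    proof -
      have "c \<noteq> \<theta>" "d \<noteq> \<theta>" using ne[OF cd(3)] ne[OF cd(4)] by auto
      \<comment> \<open>The chord from \<open>c\<close> to \<open>- d\<close> would otherwise cross
        the diameter from \<open>\<theta>\<close> to \<open>- \<theta>\<close>.\<close>
      moreover have "\<not> (c < \<theta> \<and> d < \<theta>)"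
        using NC_B_noncrossing[OF nc B(1) Z(1) cd(3,4) \<theta>(1,2)] cd \<theta> BZ by (auto simp: cpos_def)
      moreover have "\<not> (\<theta> < c \<and> \<theta> < d)"
        using NC_B_noncrossing[OF nc Z(1) B(1) \<theta>(1,2) cd(3,4)] cd \<theta> BZ bd[OF B(1) cd(3)]
        by (auto simp: cpos_def)
      ultimately show ?thesis by linarith
    qed
    have same: "c \<le> \<theta> \<longleftrightarrow> d \<le> \<theta>" if cd: "0 < c" "c < d" "c \<in> B" "d \<in> B" for c d
    proof -
      have "c \<noteq> \<theta>" "d \<noteq> \<theta>" using ne[OF cd(3)] ne[OF cd(4)] by auto
      moreover have "\<not> (c < \<theta> \<and> \<theta> < d)"
        using NC_B_noncrossing[OF nc B(1) Z(1) cd(3,4) \<theta>(1,2)] cd \<theta> BZ bd[OF B(1) cd(4)]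
        by (auto simp: cpos_def)
      ultimately show ?thesis using cd(2) by linarith
    qed
    show ?thesis using opp same unfolding \<theta>_def by blast
  qed
  then have opp: "\<And>c d. \<lbrakk>0 < c; 0 < d; c \<in> B; - d \<in> B\<rbrakk> \<Longrightarrow> c \<le> threshold x \<longleftrightarrow> \<not> d \<le> threshold x"
    and same: "\<And>c d. \<lbrakk>0 < c; c < d; c \<in> B; d \<in> B\<rbrakk> \<Longrightarrow> c \<le> threshold x \<longleftrightarrow> d \<le> threshold x"
    by blast+
  show "c \<le> threshold x \<longleftrightarrow> \<not> d \<le> threshold x" if "c \<in> B" "- d \<in> B"
    by (rule opp[OF pos that])
  show "c \<le> threshold x \<longleftrightarrow> d \<le> threshold x" if "c \<in> B" "d \<in> B"
  proof (cases c d rule: linorder_cases)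
    case less
    then show ?thesis by (rule same[OF pos(1) _ that])
  next
    case greater
    then show ?thesis using same[OF pos(2) _ that(2,1)] by blast
  qed simp
qed

text \<open>Two negative elements are treated in \<open>neg_set B\<close>, which is subject to the
  same mark.\<close>

lemma sign_rule:
  assumes nc: "\<pi> \<in> NC_B n" and m: "is_mark \<pi> x" and B: "B \<in> \<pi>" "neg_set B \<noteq> B"
    and mem: "c \<in> B" "d \<in> B"
  shows "(0 < c \<longleftrightarrow> \<bar>c\<bar> \<le> threshold x) \<longleftrightarrow> (0 < d \<longleftrightarrow> \<bar>d\<bar> \<le> threshold x)"
proof -
  note p = NC_B_partition[OF nc]
  have ne: "c \<noteq> 0" "d \<noteq> 0" using partition_B_elem[OF p B(1)] mem by blast+
  note N = partition_B_neg[OF p B(1)]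
  have B': "neg_set (neg_set B) \<noteq> neg_set B" using B(2) by auto
  note o = sign_rule_opp[OF nc m B] and s = sign_rule_same[OF nc m B]
    and s' = sign_rule_same[OF nc m N B']
  consider "0 < c" "0 < d" | "0 < c" "0 < - d" | "0 < - c" "0 < d" | "0 < - c" "0 < - d"
    using ne by linarith
  then show ?thesis
  proof cases
    case 1 then show ?thesis using s[of c d] mem by auto
  next
    case 2 then show ?thesis using o[of c "- d"] mem by auto
  next
    case 3 then show ?thesis using o[of d "- c"] mem by auto
  next
    case 4 then show ?thesis using s'[of "- c" "- d"] mem by auto
  qed
qed

text \<open>By \<open>sign_rule\<close> the sign pattern holds at every element of \<open>B\<close>
  or at none. In the latter case it holds throughout \<open>neg_set B\<close>, since negation flips
  signs and keeps absolute values.\<close>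

lemma signed_abs_image:
  assumes nc: "\<pi> \<in> NC_B n" and m: "is_mark \<pi> x" and B: "B \<in> \<pi>" "neg_set B \<noteq> B"
  shows "B = signed (threshold x) (abs ` B) \<or> B = neg_set (signed (threshold x) (abs ` B))"
proof -
  note p = NC_B_partition[OF nc]
  have *: "C = signed (threshold x) (abs ` C)"
    if C: "C \<in> \<pi>" "neg_set C \<noteq> C" and c: "c \<in> C" "0 < c \<longleftrightarrow> \<bar>c\<bar> \<le> threshold x" for C c
  proof (rule set_eqI)
    fix y
    have rule: "0 < z \<longleftrightarrow> \<bar>z\<bar> \<le> threshold x" if "z \<in> C" for z
      using sign_rule[OF nc m C c(1) that] c(2) by blast
    show "y \<in> C \<longleftrightarrow> y \<in> signed (threshold x) (abs ` C)"
    proof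
      assume "y \<in> C"
      then show "y \<in> signed (threshold x) (abs ` C)" using rule unfolding signed_def by blast
    next
      assume y: "y \<in> signed (threshold x) (abs ` C)"
      then have "\<bar>y\<bar> \<in> C \<or> - \<bar>y\<bar> \<in> C" unfolding signed_def mem_Collect_eq abs_image_iff by blast
      then have "y \<in> C \<or> - y \<in> C" by (auto simp: abs_if split: if_splits)
      moreover have "y \<in> C" if "- y \<in> C"
        using rule[OF that] y partition_B_elem[OF p C(1) that] unfolding signed_def by auto
      ultimately show "y \<in> C" by blast
    qed
  qed
  obtain c where c: "c \<in> B" using partition_B_nonempty[OF p B(1)] by blast
  show ?thesis
  proof (cases "0 < c \<longleftrightarrow> \<bar>c\<bar> \<le> threshold x")
    case True
    then show ?thesis using *[OF B c] by blast
  next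
    case False
    have "neg_set B = signed (threshold x) (abs ` neg_set B)"
      by (rule *[OF partition_B_neg[OF p B(1)], of "- c"])
        (use B(2) c False partition_B_elem[OF p B(1) c] in auto)
    then show ?thesis by (simp add: abs_image_neg_set neg_set_eq_iff)
  qed
qed

lemma unfold_marked_abs_blocks:
  assumes nc: "\<pi> \<in> NC_B n" and m: "is_mark \<pi> x"
  shows "unfold_marked (abs_blocks \<pi>, x) = \<pi>"
proof -
  note p = NC_B_partition[OF nc]
  let ?f = "\<lambda>S. if x = Block_Mark S then {S \<union> neg_set S}
     else {signed (threshold x) S, neg_set (signed (threshold x) S)}"
  have f: "?f (abs ` B) = {B, neg_set B}" if B: "B \<in> \<pi>" for B
  proof (cases "neg_set B = B")
    case True
    then have "x = Block_Mark (abs ` B)" using is_mark_zero_block[OF p m B] by blast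
    then show ?thesis using zero_block_abs_image(2)[OF p B True] True by simp
  next
    case False
    then have "x \<noteq> Block_Mark (abs ` B)" using is_mark_zero_block[OF p m B] by blast
    moreover consider "B = signed (threshold x) (abs ` B)" | "neg_set B = signed (threshold x) (abs ` B)"
      using signed_abs_image[OF nc m B False] unfolding neg_set_eq_iff by blast
    then have "{signed (threshold x) (abs ` B), neg_set (signed (threshold x) (abs ` B))} = {B, neg_set B}"
    proof cases
      case 1
      show ?thesis unfolding 1[symmetric] ..
    next
      case 2
      show ?thesis unfolding 2[symmetric] neg_set_neg_set by (rule insert_commute)
    qed
    ultimately show ?thesis by simp
  qed
  have "unfold_marked (abs_blocks \<pi>, x) = (\<Union>B\<in>\<pi>. ?f (abs ` B))"
    unfolding unfold_marked_def abs_blocks_def prod.case image_image ..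
  also have "\<dots> = (\<Union>B\<in>\<pi>. {B, neg_set B})" using f by (intro SUP_cong refl)
  also have "\<dots> = \<pi>" using partition_B_neg[OF p] by blast
  finally show ?thesis .
qed

text \<open>Inclusion instead of equality makes the statement cover the zero block, of which
  \<open>signed\<close> selects one half. Every \<open>S\<close> thus has a copy inside one block on
  a common half circle.\<close>

lemma signed_subset_block:
  assumes nc: "\<pi> \<in> NC_B n" and m: "is_mark \<pi> x" and S: "S \<in> abs_blocks \<pi>"
  shows "\<exists>B\<in>\<pi>. S = abs ` B \<and> signed (threshold x) S \<subseteq> B"
proof -
  note p = NC_B_partition[OF nc]
  obtain B where B: "B \<in> \<pi>" "S = abs ` B" using S unfolding abs_blocks_def by blast
  show ?thesis
  proof (cases "neg_set B = B")
    case True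
    have "y \<in> B" if "\<bar>y\<bar> \<in> abs ` B" for y
    proof -
      have "\<bar>y\<bar> \<in> B \<or> - \<bar>y\<bar> \<in> B" using that unfolding abs_image_iff by blast
      then have "y \<in> B \<or> - y \<in> B" by (auto simp: abs_if split: if_splits)
      then have "y \<in> B \<or> y \<in> neg_set B" unfolding mem_neg_set .
      then show ?thesis unfolding True by blast
    qed
    then have "signed (threshold x) S \<subseteq> B" unfolding signed_def B(2) by blast
    then show ?thesis using B by blast
  next
    case False
    from signed_abs_image[OF nc m B(1) False] show ?thesis
    proof
      assume "B = signed (threshold x) (abs ` B)"
      then show ?thesis using B by blast
    next
      assume "B = neg_set (signed (threshold x) (abs ` B))"
      then have "neg_set B = signed (threshold x) S" using B(2) unfolding neg_set_eq_iff by simp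
      then show ?thesis using B(2) partition_B_neg[OF p B(1)] abs_image_neg_set[of B]
        by (intro bexI[of _ "neg_set B"]) simp_all
    qed
  qed
qed

section \<open>The values of \<open>psi_B\<close> are marked noncrossing partitions\<close>

lemma abs_blocks_partition:
  assumes p: "partition_B n \<pi>"
  shows "partition_on {1..int n} (abs_blocks \<pi>)"
proof (rule partition_onI)
  show "\<Union> (abs_blocks \<pi>) = {1..int n}"
  proof (intro equalityI subsetI)
    fix y assume "y \<in> \<Union> (abs_blocks \<pi>)"
    then obtain B z where "B \<in> \<pi>" "z \<in> B" "y = \<bar>z\<bar>" unfolding abs_blocks_def by blast
    then show "y \<in> {1..int n}" using partition_B_elem[OF p] by force
  next
    fix y assume y: "y \<in> {1..int n}"
    then obtain B where "B \<in> \<pi>" "y \<in> B" using partition_B_cover[OF p, of y] by auto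
    then show "y \<in> \<Union> (abs_blocks \<pi>)" unfolding abs_blocks_def using y by (force simp: image_iff)
  qed
  show "{} \<notin> abs_blocks \<pi>" using partition_B_nonempty[OF p] unfolding abs_blocks_def by blast
  show "disjnt S T" if ST: "S \<in> abs_blocks \<pi>" "T \<in> abs_blocks \<pi>" "S \<noteq> T" for S T
  proof -
    obtain B C where BC: "B \<in> \<pi>" "C \<in> \<pi>" "S = abs ` B" "T = abs ` C"
      using ST unfolding abs_blocks_def by blast
    have "y \<notin> T" if "y \<in> S" for y
      using abs_image_eqD[OF p BC(1,2)] that BC(3,4) ST(3) abs_image_neg_set[of B] by metis
    then show ?thesis unfolding disjnt_def by blast
  qed
qed

text \<open>The lift \<open>g\<close> keeps \<open>y\<close> up to the threshold and negates it
  beyond. Then \<open>cpos n (g y)\<close> is \<open>y\<close> or \<open>int n + y\<close>, hence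
  strictly increasing in \<open>y\<close>, and a crossing in \<open>abs_blocks \<pi>\<close> lifts
  to a crossing in \<open>\<pi>\<close>.\<close>

lemma abs_blocks_NC:
  assumes nc: "\<pi> \<in> NC_B n" and m: "is_mark \<pi> x"
  shows "abs_blocks \<pi> \<in> NC n"
proof (rule NC_I[OF abs_blocks_partition[OF NC_B_partition[OF nc]]])
  fix S T a b c d
  assume ST: "S \<in> abs_blocks \<pi>" "T \<in> abs_blocks \<pi>" and mem: "a \<in> S" "b \<in> S" "c \<in> T" "d \<in> T"
    and lt: "a < c" "c < b" "b < d"
  note p = NC_B_partition[OF nc]
  define g where "g y = (if y \<le> threshold x then y else - y)" for y
  obtain B where B: "B \<in> \<pi>" "S = abs ` B" "signed (threshold x) S \<subseteq> B"
    using signed_subset_block[OF nc m ST(1)] by blast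
  obtain C where C: "C \<in> \<pi>" "T = abs ` C" "signed (threshold x) T \<subseteq> C"
    using signed_subset_block[OF nc m ST(2)] by blast
  have bound: "0 < y \<and> y \<le> int n" if "y \<in> S \<or> y \<in> T" for y
  proof -
    have "y \<in> \<Union> (abs_blocks \<pi>)" using that ST by blast
    then show ?thesis using abs_blocks_partition[OF p] unfolding partition_on_def by simp
  qed
  have g: "g y \<in> signed (threshold x) R" if "y \<in> R" "0 < y" for y R
    using that unfolding g_def signed_def by auto
  have "g a \<in> B" "g b \<in> B" "g c \<in> C" "g d \<in> C"
    using subsetD[OF B(3) g[of a]] subsetD[OF B(3) g[of b]] subsetD[OF C(3) g[of c]]
      subsetD[OF C(3) g[of d]] mem bound by simp_all
  moreover have "cpos n (g a) < cpos n (g c)" "cpos n (g c) < cpos n (g b)" "cpos n (g b) < cpos n (g d)"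
    using lt bound[of a] bound[of b] bound[of c] bound[of d] mem by (auto simp: cpos_def g_def)
  ultimately have "B = C" by (intro NC_B_noncrossing[OF nc B(1) C(1)])
  then show "S = T" using B C by simp
qed

lemma abs_blocks_marked:
  assumes nc: "\<pi> \<in> NC_B n" and m: "is_mark \<pi> x"
  shows "(abs_blocks \<pi>, x) \<in> NC_marked n"
proof -
  note p = NC_B_partition[OF nc]
  have "case x of No_Mark \<Rightarrow> True | Edge_Mark e \<Rightarrow> e \<in> edges (abs_blocks \<pi>)
    | Block_Mark A \<Rightarrow> A \<in> abs_blocks \<pi>"
  proof (cases x)
    case (Edge_Mark e)
    obtain a b where e: "e = (a, b)" by fastforce
    obtain B where B: "B \<in> \<pi>" "a \<in> B" "- b \<in> B" and ab: "0 < a" "a < b"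
      and inner: "\<And>C c d. \<lbrakk>C \<in> \<pi>; 0 < c; c < d; c \<in> C; - d \<in> C\<rbrakk> \<Longrightarrow> c \<le> a \<and> b \<le> d"
      using m Edge_Mark e by auto
    have "\<not> (a < k \<and> k < b)" if "k \<in> abs ` B" for k
    proof
      assume k: "a < k \<and> k < b"
      have "k \<in> B \<or> - k \<in> B" using that unfolding abs_image_iff by blast
      \<comment> \<open>Either \<open>k\<close> with \<open>- b\<close> or \<open>a\<close> with
        \<open>- k\<close> would be a pair further inside than \<open>a\<close> with
        \<open>- b\<close>.\<close>
      then show False using inner[OF B(1), of k b] inner[OF B(1), of a k] B ab k by auto
    qed
    moreover have "a \<in> abs ` B" "b \<in> abs ` B" using B ab unfolding abs_image_iff by auto
    moreover have "abs ` B \<in> abs_blocks \<pi>" using B(1) unfolding abs_blocks_def by blast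
    ultimately have "(a, b) \<in> edges (abs_blocks \<pi>)" unfolding edges_def using ab(2) by blast
    then show ?thesis using Edge_Mark e by simp
  next
    case (Block_Mark A)
    then obtain Z where Z: "Z \<in> \<pi>" "neg_set Z = Z" "A = pos_part Z" using m by auto
    then have "A = abs ` Z" using zero_block_abs_image(1)[OF p] by simp
    then show ?thesis using Z(1) Block_Mark unfolding abs_blocks_def by simp
  qed simp
  then show ?thesis using abs_blocks_NC[OF nc m] unfolding NC_marked_def by simp
qed

section \<open>Crossings on the circle cut along a diameter\<close>

lemma mem_unfold_marked:
  "B \<in> unfold_marked (\<sigma>, x) \<longleftrightarrow> (\<exists>S\<in>\<sigma>. (x = Block_Mark S \<and> B = S \<union> neg_set S) \<or>
     (x \<noteq> Block_Mark S \<and> (B = signed (threshold x) S \<or> B = neg_set (signed (threshold x) S))))"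
  unfolding unfold_marked_def by (auto split: if_splits)

text \<open>All eight linear orders in which the pairs \<open>{a, b}\<close> and
  \<open>{c, d}\<close> alternate. Listing all of them makes the condition invariant under rotation,
  as needed because a half circle meets the absolute values in a rotated order.\<close>

definition unlinked :: "int \<Rightarrow> int \<Rightarrow> int \<Rightarrow> int \<Rightarrow> bool" where
  "unlinked a b c d \<longleftrightarrow> \<not> (a < c \<and> c < b \<and> b < d) \<and> \<not> (b < c \<and> c < a \<and> a < d) \<and>
     \<not> (a < d \<and> d < b \<and> b < c) \<and> \<not> (b < d \<and> d < a \<and> a < c) \<and>
     \<not> (c < a \<and> a < d \<and> d < b) \<and> \<not> (d < a \<and> a < c \<and> c < b) \<and>
     \<not> (c < b \<and> b < d \<and> d < a) \<and> \<not> (d < b \<and> b < c \<and> c < a)"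

lemma NC_unlinked:
  assumes "\<sigma> \<in> NC n" "S \<in> \<sigma>" "T \<in> \<sigma>" "S \<noteq> T" "a \<in> S" "b \<in> S" "c \<in> T" "d \<in> T"
  shows "unlinked a b c d"
  unfolding unlinked_def
  using NC_noncrossing[OF assms(1,2,3)] NC_noncrossing[OF assms(1,3,2)] assms(4-) by blast

text \<open>One half circle is an interval of positions and the other is its complement, so pairs
  from different halves cannot alternate.\<close>

lemma halves_noncrossing:
  assumes "\<bar>a\<bar> \<le> int n" "\<bar>b\<bar> \<le> int n" "\<bar>c\<bar> \<le> int n" "\<bar>d\<bar> \<le> int n" "a \<noteq> 0" "b \<noteq> 0" "c \<noteq> 0" "d \<noteq> 0"
    and "0 < a \<longleftrightarrow> \<bar>a\<bar> \<le> \<theta>" "0 < b \<longleftrightarrow> \<bar>b\<bar> \<le> \<theta>" "\<not> (0 < c \<longleftrightarrow> \<bar>c\<bar> \<le> \<theta>)" "\<not> (0 < d \<longleftrightarrow> \<bar>d\<bar> \<le> \<theta>)"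
  shows "\<not> (cpos n a < cpos n c \<and> cpos n c < cpos n b \<and> cpos n b < cpos n d)"
    and "\<not> (cpos n c < cpos n a \<and> cpos n a < cpos n d \<and> cpos n d < cpos n b)"
  using assms unfolding cpos_def by (smt (verit))+

text \<open>Along a half circle \<open>cpos\<close> orders the elements as their absolute values, up
  to a rotation that starts after \<open>\<theta>\<close>.\<close>

lemma half_noncrossing:
  assumes "\<bar>a\<bar> \<le> int n" "\<bar>b\<bar> \<le> int n" "\<bar>c\<bar> \<le> int n" "\<bar>d\<bar> \<le> int n" "a \<noteq> 0" "b \<noteq> 0" "c \<noteq> 0" "d \<noteq> 0"
    and "(0 < a \<longleftrightarrow> \<bar>a\<bar> \<le> \<theta>) = h" "(0 < b \<longleftrightarrow> \<bar>b\<bar> \<le> \<theta>) = h"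
    "(0 < c \<longleftrightarrow> \<bar>c\<bar> \<le> \<theta>) = h" "(0 < d \<longleftrightarrow> \<bar>d\<bar> \<le> \<theta>) = h"
    and "unlinked \<bar>a\<bar> \<bar>b\<bar> \<bar>c\<bar> \<bar>d\<bar>"
  shows "\<not> (cpos n a < cpos n c \<and> cpos n c < cpos n b \<and> cpos n b < cpos n d)"
  using assms unfolding cpos_def unlinked_def by (cases h) (smt (verit))+

text \<open>In the rotated order of absolute values on a half circle, \<open>\<theta>\<close> comes
  last. Not linking \<open>\<bar>a\<bar>\<close>, \<open>\<theta>\<close> with
  \<open>\<bar>c\<bar>\<close>, \<open>\<bar>d\<bar>\<close> therefore says that neither
  \<open>a\<close> nor \<open>- a\<close> lies between \<open>c\<close> and \<open>d\<close> in
  their half; the same holds for \<open>b\<close>. This also covers chords of the zero block that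
  join the two halves.\<close>

lemma zero_block_noncrossing:
  assumes "\<bar>a\<bar> \<le> \<theta>" "\<bar>b\<bar> \<le> \<theta>" "\<theta> \<le> int n" "\<bar>c\<bar> \<le> int n" "\<bar>d\<bar> \<le> int n"
    and "a \<noteq> 0" "b \<noteq> 0" "c \<noteq> 0" "d \<noteq> 0" "\<bar>c\<bar> \<noteq> \<theta>" "\<bar>d\<bar> \<noteq> \<theta>"
    and "(0 < c \<longleftrightarrow> \<bar>c\<bar> \<le> \<theta>) = h" "(0 < d \<longleftrightarrow> \<bar>d\<bar> \<le> \<theta>) = h"
    and "unlinked \<bar>a\<bar> \<bar>b\<bar> \<bar>c\<bar> \<bar>d\<bar>" "unlinked \<bar>a\<bar> \<theta> \<bar>c\<bar> \<bar>d\<bar>" "unlinked \<bar>b\<bar> \<theta> \<bar>c\<bar> \<bar>d\<bar>"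
  shows "\<not> (cpos n a < cpos n c \<and> cpos n c < cpos n b \<and> cpos n b < cpos n d)"
    and "\<not> (cpos n c < cpos n a \<and> cpos n a < cpos n d \<and> cpos n d < cpos n b)"
  using assms unfolding cpos_def unlinked_def by (cases h; smt (verit))+

text \<open>The parameter \<open>h\<close> selects the half circle, so that \<open>signed\<close>
  and its negative are handled by one argument.\<close>

definition half_lift :: "int \<Rightarrow> bool \<Rightarrow> int set \<Rightarrow> int set" where
  "half_lift \<theta> h S = {y. \<bar>y\<bar> \<in> S \<and> (0 < y \<longleftrightarrow> \<bar>y\<bar> \<le> \<theta>) = h}"

definition full_lift :: "int set \<Rightarrow> int set" where
  "full_lift S = {y. \<bar>y\<bar> \<in> S}"

lemma neg_half_lift:
  assumes "\<And>y. y \<in> S \<Longrightarrow> 0 < y"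
  shows "neg_set (half_lift \<theta> h S) = half_lift \<theta> (\<not> h) S"
proof (rule set_eqI)
  fix y
  show "y \<in> neg_set (half_lift \<theta> h S) \<longleftrightarrow> y \<in> half_lift \<theta> (\<not> h) S"
    using assms[of "\<bar>y\<bar>"] by (cases h) (auto simp: half_lift_def)
qed

lemma neg_full_lift: "neg_set (full_lift S) = full_lift S"
  by (auto simp: full_lift_def)

lemma abs_half_lift:
  assumes "\<And>y. y \<in> S \<Longrightarrow> 0 < y"
  shows "abs ` half_lift \<theta> h S = S"
proof (rule set_eqI)
  fix y
  show "y \<in> abs ` half_lift \<theta> h S \<longleftrightarrow> y \<in> S"
    unfolding abs_image_iff half_lift_def mem_Collect_eq using assms[of y] by (cases h) auto
qed

lemma abs_full_lift:
  assumes "\<And>y. y \<in> S \<Longrightarrow> 0 < y"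
  shows "abs ` full_lift S = S"
proof (rule set_eqI)
  fix y
  show "y \<in> abs ` full_lift S \<longleftrightarrow> y \<in> S"
    unfolding abs_image_iff full_lift_def mem_Collect_eq using assms[of y] by auto
qed

lemma mem_unfold_marked_lift:
  assumes pos: "\<And>S y. \<lbrakk>S \<in> \<sigma>; y \<in> S\<rbrakk> \<Longrightarrow> 0 < y"
  shows "B \<in> unfold_marked (\<sigma>, x) \<longleftrightarrow> (\<exists>S\<in>\<sigma>. (x = Block_Mark S \<and> B = full_lift S) \<or>
     (x \<noteq> Block_Mark S \<and> (\<exists>h. B = half_lift (threshold x) h S)))"
proof -
  have 1: "signed \<theta> S = half_lift \<theta> True S" for \<theta> S
    by (simp add: signed_def half_lift_def)
  have 2: "neg_set (signed \<theta> S) = half_lift \<theta> False S" if "S \<in> \<sigma>" for \<theta> S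
    unfolding 1 using neg_half_lift[of S \<theta> True] pos[OF that] by simp
  have 3: "S \<union> neg_set S = full_lift S" if "S \<in> \<sigma>" for S
    using pos[OF that] by (force simp: full_lift_def abs_if split: if_splits)
  have 4: "(B = signed \<theta> S \<or> B = neg_set (signed \<theta> S)) \<longleftrightarrow> (\<exists>h. B = half_lift \<theta> h S)"
    if "S \<in> \<sigma>" for \<theta> S
    unfolding 2[OF that] unfolding 1 by (simp add: ex_bool_eq)
  show ?thesis unfolding mem_unfold_marked using 3 4 by (intro bex_cong refl) simp
qed

section \<open>The partition unfolded from a marked noncrossing partition\<close>

locale marked_partition =
  fixes n :: nat and \<sigma> :: "int set set" and x :: mark
  assumes marked: "(\<sigma>, x) \<in> NC_marked n"
begin

lemma nc: "\<sigma> \<in> NC n" and part: "partition_on {1..int n} \<sigma>"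
  and mark: "case x of No_Mark \<Rightarrow> True | Edge_Mark e \<Rightarrow> e \<in> edges \<sigma> | Block_Mark A \<Rightarrow> A \<in> \<sigma>"
proof -
  show "\<sigma> \<in> NC n" using marked unfolding NC_marked_def by simp
  then show "partition_on {1..int n} \<sigma>" unfolding NC_def by blast
  show "case x of No_Mark \<Rightarrow> True | Edge_Mark e \<Rightarrow> e \<in> edges \<sigma> | Block_Mark A \<Rightarrow> A \<in> \<sigma>"
    using marked unfolding NC_marked_def by simp
qed

lemma elem: "\<lbrakk>S \<in> \<sigma>; y \<in> S\<rbrakk> \<Longrightarrow> 0 < y \<and> y \<le> int n"
proof -
  assume "S \<in> \<sigma>" "y \<in> S"
  then have "y \<in> \<Union>\<sigma>" by blast
  then show ?thesis using part unfolding partition_on_def by simp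
qed

lemma cover: "\<lbrakk>0 < y; y \<le> int n\<rbrakk> \<Longrightarrow> \<exists>S\<in>\<sigma>. y \<in> S"
proof -
  assume "0 < y" "y \<le> int n"
  then have "y \<in> {1..int n}" by simp
  then have "y \<in> \<Union>\<sigma>" using part unfolding partition_on_def by simp
  then show ?thesis by blast
qed

lemma unique: "\<lbrakk>S \<in> \<sigma>; T \<in> \<sigma>; y \<in> S; y \<in> T\<rbrakk> \<Longrightarrow> S = T"
  using part unfolding partition_on_def disjoint_def by blast

lemma nonempty: "S \<in> \<sigma> \<Longrightarrow> S \<noteq> {}"
  using part unfolding partition_on_def by blast

lemma block_finite: "S \<in> \<sigma> \<Longrightarrow> finite S"
  by (rule finite_subset[of _ "{1..int n}"]) (use elem in force, simp)

lemma pos: "\<lbrakk>S \<in> \<sigma>; y \<in> S\<rbrakk> \<Longrightarrow> 0 < y"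
  using elem by blast

lemma mem_unfold:
  "B \<in> unfold_marked (\<sigma>, x) \<longleftrightarrow> (\<exists>S\<in>\<sigma>. (x = Block_Mark S \<and> B = full_lift S) \<or>
     (x \<noteq> Block_Mark S \<and> (\<exists>h. B = half_lift (threshold x) h S)))"
  by (rule mem_unfold_marked_lift) (rule pos)

lemma unfold_elemE:
  assumes "B \<in> unfold_marked (\<sigma>, x)"
  obtains (full) S where "S \<in> \<sigma>" "x = Block_Mark S" "B = full_lift S"
  | (half) S h where "S \<in> \<sigma>" "x \<noteq> Block_Mark S" "B = half_lift (threshold x) h S"
proof -
  from assms obtain S where S: "S \<in> \<sigma>" and
    "(x = Block_Mark S \<and> B = full_lift S) \<or>
     (x \<noteq> Block_Mark S \<and> (\<exists>h. B = half_lift (threshold x) h S))"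
    unfolding mem_unfold by (rule bexE)
  then show thesis using full[OF S] half[OF S] by metis
qed

lemma half_in: "\<lbrakk>S \<in> \<sigma>; x \<noteq> Block_Mark S\<rbrakk> \<Longrightarrow> half_lift (threshold x) h S \<in> unfold_marked (\<sigma>, x)"
  unfolding mem_unfold by (intro bexI[of _ S] disjI2 conjI exI[of _ h] refl)

lemma full_in: "\<lbrakk>S \<in> \<sigma>; x = Block_Mark S\<rbrakk> \<Longrightarrow> full_lift S \<in> unfold_marked (\<sigma>, x)"
  unfolding mem_unfold by (intro bexI[of _ S] disjI1 conjI refl)

lemma abs_unfold: "abs_blocks (unfold_marked (\<sigma>, x)) = \<sigma>"
proof (intro equalityI subsetI)
  fix S assume "S \<in> abs_blocks (unfold_marked (\<sigma>, x))"
  then obtain B where B: "B \<in> unfold_marked (\<sigma>, x)" "S = abs ` B" unfolding abs_blocks_def by blast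
  from B(1) show "S \<in> \<sigma>"
    by (cases rule: unfold_elemE) (simp_all add: B(2) abs_half_lift abs_full_lift pos)
next
  fix S assume S: "S \<in> \<sigma>"
  show "S \<in> abs_blocks (unfold_marked (\<sigma>, x))"
  proof (cases "x = Block_Mark S")
    case True
    show ?thesis unfolding abs_blocks_def
      by (rule image_eqI[OF _ full_in[OF S True]]) (simp add: abs_full_lift pos[OF S])
  next
    case False
    show ?thesis unfolding abs_blocks_def
      by (rule image_eqI[OF _ half_in[OF S False, of True]]) (simp add: abs_half_lift pos[OF S])
  qed
qed

lemma half_lift_nonempty: "S \<in> \<sigma> \<Longrightarrow> half_lift \<theta> h S \<noteq> {}"
  using abs_half_lift[of S \<theta> h] pos nonempty by blast

lemma full_lift_nonempty: "S \<in> \<sigma> \<Longrightarrow> full_lift S \<noteq> {}"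
  using abs_full_lift[of S] pos nonempty by blast

lemma neg_half_lift_neq: "S \<in> \<sigma> \<Longrightarrow> neg_set (half_lift \<theta> h S) \<noteq> half_lift \<theta> h S"
proof
  assume S: "S \<in> \<sigma>" and eq: "neg_set (half_lift \<theta> h S) = half_lift \<theta> h S"
  have "half_lift \<theta> (\<not> h) S = half_lift \<theta> h S"
    using neg_half_lift[of S \<theta> h] pos[OF S] eq by simp
  moreover obtain y where "y \<in> half_lift \<theta> h S" using half_lift_nonempty[OF S] by blast
  ultimately show False unfolding half_lift_def by blast
qed

lemma partition_unfold: "partition_B n (unfold_marked (\<sigma>, x))"
  unfolding partition_B_def
proof (intro conjI ballI impI)
  let ?\<pi> = "unfold_marked (\<sigma>, x)"
  show "partition_on (pm_interval n) ?\<pi>"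
  proof (rule partition_onI)
    show "\<Union> ?\<pi> = pm_interval n"
    proof (intro equalityI subsetI)
      fix y assume "y \<in> \<Union> ?\<pi>"
      then obtain B where B: "B \<in> ?\<pi>" "y \<in> B" by blast
      from B(1) have "\<exists>S\<in>\<sigma>. \<bar>y\<bar> \<in> S"
        by (cases rule: unfold_elemE) (use B(2) in \<open>auto simp: half_lift_def full_lift_def\<close>)
      then have "0 < \<bar>y\<bar> \<and> \<bar>y\<bar> \<le> int n" using elem by blast
      then show "y \<in> pm_interval n" unfolding pm_interval_def by auto
    next
      fix y assume "y \<in> pm_interval n"
      then have "0 < \<bar>y\<bar>" "\<bar>y\<bar> \<le> int n" unfolding pm_interval_def by auto
      then obtain S where S: "S \<in> \<sigma>" "\<bar>y\<bar> \<in> S" using cover by blast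
      show "y \<in> \<Union> ?\<pi>"
      proof (cases "x = Block_Mark S")
        case True
        then show ?thesis using full_in[OF S(1)] S(2) unfolding full_lift_def by blast
      next
        case False
        \<comment> \<open>The instance of \<open>h\<close> names the half circle on which
          \<open>y\<close> lies.\<close>
        then show ?thesis using half_in[OF S(1), of "0 < y \<longleftrightarrow> \<bar>y\<bar> \<le> threshold x"] S(2)
          unfolding half_lift_def by blast
      qed
    qed
    show "{} \<notin> ?\<pi>"
    proof
      assume "{} \<in> ?\<pi>"
      then show False
        by (cases rule: unfold_elemE) (metis full_lift_nonempty, metis half_lift_nonempty)
    qed
    show "disjnt B C" if BC: "B \<in> ?\<pi>" "C \<in> ?\<pi>" "B \<noteq> C" for B C
    proof -
      have "B = C" if y: "y \<in> B" "y \<in> C" for y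
        using BC(1)
      proof (cases rule: unfold_elemE)
        case (full S)
        from BC(2) show ?thesis
        proof (cases rule: unfold_elemE)
          case (full T)
          then show ?thesis using \<open>x = Block_Mark S\<close> \<open>B = full_lift S\<close> by simp
        next
          case (half T h)
          then have "S = T" using unique[OF \<open>S \<in> \<sigma>\<close> half(1), of "\<bar>y\<bar>"] y full(3)
            unfolding full_lift_def half_lift_def by blast
          then show ?thesis using full(2) half(2) by simp
        qed
      next
        case (half S h)
        from BC(2) show ?thesis
        proof (cases rule: unfold_elemE)
          case (full T)
          then have "S = T" using unique[OF \<open>S \<in> \<sigma>\<close> full(1), of "\<bar>y\<bar>"] y half(3)
            unfolding full_lift_def half_lift_def by blast
          then show ?thesis using full(2) half(2) by simp
        next
          case (half T h')
          then have "S = T" using unique[OF \<open>S \<in> \<sigma>\<close> half(1), of "\<bar>y\<bar>"] y \<open>B = half_lift (threshold x) h S\<close>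
            unfolding half_lift_def by blast
          moreover have "h = h'" using y half(3) \<open>B = half_lift (threshold x) h S\<close>
            unfolding half_lift_def by blast
          ultimately show ?thesis using half(3) \<open>B = half_lift (threshold x) h S\<close> by simp
        qed
      qed
      then show ?thesis using BC(3) unfolding disjnt_def by blast
    qed
  qed
  show "neg_set B \<in> ?\<pi>" if "B \<in> ?\<pi>" for B
    using that
  proof (cases rule: unfold_elemE)
    case (full S)
    then show ?thesis using that by (simp add: neg_full_lift)
  next
    case (half S h)
    then show ?thesis using half_in[OF half(1,2), of "\<not> h"] neg_half_lift[of S] pos[OF half(1)] by simp
  qed
  show "B = C" if BC: "B \<in> ?\<pi>" "C \<in> ?\<pi>" "B = neg_set B \<and> C = neg_set C" for B C
  proof -
    have *: "\<exists>S. x = Block_Mark S \<and> D = full_lift S" if "D \<in> ?\<pi>" "D = neg_set D" for D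
      using that(1) by (cases rule: unfold_elemE) (use that(2) neg_half_lift_neq in metis)+
    show ?thesis using *[OF BC(1)] *[OF BC(2)] BC(3) by auto
  qed
qed

lemma threshold_full:
  assumes "S \<in> \<sigma>" "x = Block_Mark S"
  shows "threshold x \<in> S" "\<And>y. y \<in> S \<Longrightarrow> y \<le> threshold x" "threshold x \<le> int n"
proof -
  show "threshold x \<in> S" using Max_in[OF block_finite[OF assms(1)] nonempty[OF assms(1)]] assms(2) by simp
  then show "threshold x \<le> int n" using elem[OF assms(1)] by blast
  show "y \<le> threshold x" if "y \<in> S" for y
    using Max_ge[OF block_finite[OF assms(1)] that] assms(2) by simp
qed

lemma full_half_noncrossing:
  assumes S: "S \<in> \<sigma>" "x = Block_Mark S" and T: "T \<in> \<sigma>" "x \<noteq> Block_Mark T"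
    and mem: "a \<in> full_lift S" "b \<in> full_lift S" "c \<in> half_lift (threshold x) h T" "d \<in> half_lift (threshold x) h T"
  shows "\<not> (cpos n a < cpos n c \<and> cpos n c < cpos n b \<and> cpos n b < cpos n d)"
    and "\<not> (cpos n c < cpos n a \<and> cpos n a < cpos n d \<and> cpos n d < cpos n b)"
proof -
  have m: "\<bar>a\<bar> \<in> S" "\<bar>b\<bar> \<in> S" "\<bar>c\<bar> \<in> T" "\<bar>d\<bar> \<in> T"
    "(0 < c \<longleftrightarrow> \<bar>c\<bar> \<le> threshold x) = h" "(0 < d \<longleftrightarrow> \<bar>d\<bar> \<le> threshold x) = h"
    using mem unfolding full_lift_def half_lift_def by blast+
  have "S \<noteq> T" using S(2) T(2) by blast
  note u = NC_unlinked[OF nc S(1) T(1) this _ _ m(3,4)]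
  note t = threshold_full[OF S]
  have ne: "a \<noteq> 0" "b \<noteq> 0" "c \<noteq> 0" "d \<noteq> 0"
    using pos[OF S(1) m(1)] pos[OF S(1) m(2)] pos[OF T(1) m(3)] pos[OF T(1) m(4)] by auto
  have bd: "\<bar>c\<bar> \<le> int n" "\<bar>d\<bar> \<le> int n" using elem[OF T(1) m(3)] elem[OF T(1) m(4)] by auto
  have ct: "\<bar>c\<bar> \<noteq> threshold x" "\<bar>d\<bar> \<noteq> threshold x"
    using unique[OF S(1) T(1) t(1)] m(3,4) \<open>S \<noteq> T\<close> by auto
  note z = zero_block_noncrossing[OF t(2)[OF m(1)] t(2)[OF m(2)] t(3) bd ne ct m(5,6)
      u[OF m(1,2)] u[OF m(1) t(1)] u[OF m(2) t(1)]]
  show "\<not> (cpos n a < cpos n c \<and> cpos n c < cpos n b \<and> cpos n b < cpos n d)"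
    and "\<not> (cpos n c < cpos n a \<and> cpos n a < cpos n d \<and> cpos n d < cpos n b)"
    using z by blast+
qed

lemma half_half_noncrossing:
  assumes S: "S \<in> \<sigma>" and T: "T \<in> \<sigma>"
    and mem: "a \<in> half_lift \<theta> h S" "b \<in> half_lift \<theta> h S" "c \<in> half_lift \<theta> h' T" "d \<in> half_lift \<theta> h' T"
    and lt: "cpos n a < cpos n c" "cpos n c < cpos n b" "cpos n b < cpos n d"
  shows "S = T \<and> h = h'"
proof (rule ccontr)
  assume neq: "\<not> ?thesis"
  have m: "\<bar>a\<bar> \<in> S" "\<bar>b\<bar> \<in> S" "\<bar>c\<bar> \<in> T" "\<bar>d\<bar> \<in> T"
    "(0 < a \<longleftrightarrow> \<bar>a\<bar> \<le> \<theta>) = h" "(0 < b \<longleftrightarrow> \<bar>b\<bar> \<le> \<theta>) = h"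
    "(0 < c \<longleftrightarrow> \<bar>c\<bar> \<le> \<theta>) = h'" "(0 < d \<longleftrightarrow> \<bar>d\<bar> \<le> \<theta>) = h'"
    using mem unfolding half_lift_def by blast+
  have ne: "a \<noteq> 0" "b \<noteq> 0" "c \<noteq> 0" "d \<noteq> 0"
    using pos[OF S m(1)] pos[OF S m(2)] pos[OF T m(3)] pos[OF T m(4)] by auto
  have bd: "\<bar>a\<bar> \<le> int n" "\<bar>b\<bar> \<le> int n" "\<bar>c\<bar> \<le> int n" "\<bar>d\<bar> \<le> int n"
    using elem[OF S m(1)] elem[OF S m(2)] elem[OF T m(3)] elem[OF T m(4)] by auto
  show False
  proof (cases "h = h'")
    case True
    then have "unlinked \<bar>a\<bar> \<bar>b\<bar> \<bar>c\<bar> \<bar>d\<bar>" using NC_unlinked[OF nc S T _ m(1-4)] neq by blast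
    then show False using half_noncrossing[OF bd ne m(5,6)] m(7,8) True lt by blast
  next
    case False
    show False
    proof (cases h)
      case True
      then show False using halves_noncrossing(1)[OF bd ne] m(5-8) False lt by blast
    next
      case h: False
      then show False
        using halves_noncrossing(2)[OF bd(3,4,1,2) ne(3,4,1,2)] m(5-8) False lt by blast
    qed
  qed
qed

lemma unfold_NC_B: "unfold_marked (\<sigma>, x) \<in> NC_B n"
  unfolding NC_B_iff
proof (intro conjI ballI impI)
  show "partition_B n (unfold_marked (\<sigma>, x))" by (rule partition_unfold)
  fix B C a b c d
  assume B: "B \<in> unfold_marked (\<sigma>, x)" and C: "C \<in> unfold_marked (\<sigma>, x)"
    and mem: "a \<in> B" "b \<in> B" "c \<in> C" "d \<in> C"
    and lt: "cpos n a < cpos n c \<and> cpos n c < cpos n b \<and> cpos n b < cpos n d"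
  from B show "B = C"
  proof (cases rule: unfold_elemE)
    case B: (full S)
    from C show ?thesis
    proof (cases rule: unfold_elemE)
      case (full T)
      then show ?thesis using B by simp
    next
      case (half T h)
      then show ?thesis
        using full_half_noncrossing(1)[OF B(1,2) half(1,2)] mem lt B(3) by blast
    qed
  next
    case B: (half S h)
    from C show ?thesis
    proof (cases rule: unfold_elemE)
      case (full T)
      then show ?thesis
        using full_half_noncrossing(2)[OF full(1,2) B(1,2)] mem lt B(3) by blast
    next
      case (half T h')
      then show ?thesis
        using half_half_noncrossing[OF B(1) half(1)] mem lt B(3) by blast
    qed
  qed
qed

text \<open>For an edge mark \<open>(a, b)\<close> the threshold \<open>a\<close> puts
  \<open>a\<close> and \<open>- b\<close> on the same half. A pair further inside would need an
  element of the same block between \<open>a\<close> and \<open>b\<close>, or a block crossing the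
  edge in \<open>\<sigma>\<close>.\<close>

lemma is_mark_unfold: "is_mark (unfold_marked (\<sigma>, x)) x"
proof (cases x)
  case No_Mark
  have False if B: "B \<in> unfold_marked (\<sigma>, x)" "0 < c" "0 < d" "c \<in> B" "- d \<in> B" for B c d
    using B(1) by (cases rule: unfold_elemE) (use B No_Mark in \<open>auto simp: half_lift_def\<close>)
  then show ?thesis using No_Mark by auto
next
  case (Block_Mark A)
  then have A: "A \<in> \<sigma>" using mark by simp
  have "pos_part (full_lift A) = A"
  proof (rule set_eqI)
    fix y
    show "y \<in> pos_part (full_lift A) \<longleftrightarrow> y \<in> A"
      unfolding pos_part_def full_lift_def mem_Collect_eq using pos[OF A, of y] pos[OF A, of "\<bar>y\<bar>"] by auto
  qed
  then show ?thesis unfolding Block_Mark is_mark.simps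
    using full_in[OF A Block_Mark] neg_full_lift[of A] unfolding Block_Mark by (intro bexI[of _ "full_lift A"]) simp_all
next
  case (Edge_Mark e)
  obtain a b where e: "e = (a, b)" by fastforce
  have th: "threshold x = a" using Edge_Mark e by simp
  obtain S where S: "S \<in> \<sigma>" "a \<in> S" "b \<in> S" "a < b" and none: "\<And>k. \<lbrakk>k \<in> S; a < k; k < b\<rbrakk> \<Longrightarrow> False"
    using mark Edge_Mark e unfolding edges_def by auto
  have nB: "x \<noteq> Block_Mark T" for T using Edge_Mark by simp
  have "neg_set B \<noteq> B" if "B \<in> unfold_marked (\<sigma>, x)" for B
    using that by (cases rule: unfold_elemE) (use nB neg_half_lift_neq in auto)
  moreover have ab: "0 < a" "0 < b" using pos[OF S(1)] S(2,3) by blast+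
  moreover have "a \<in> half_lift a True S" "- b \<in> half_lift a True S"
    using S ab by (auto simp: half_lift_def)
  then have "\<exists>B\<in>unfold_marked (\<sigma>, x). a \<in> B \<and> - b \<in> B"
    using half_in[OF S(1) nB, of True] th by auto
  moreover have "c \<le> a \<and> b \<le> d"
    if C: "C \<in> unfold_marked (\<sigma>, x)" "0 < c" "c < d" "c \<in> C" "- d \<in> C" for C c d
    using C(1)
  proof (cases rule: unfold_elemE)
    case (full T)
    then show ?thesis using nB by blast
  next
    case (half T h)
    \<comment> \<open>With \<open>h\<close> false the common sign pattern of \<open>c\<close> and
      \<open>- d\<close> would give \<open>d \<le> a < c\<close>, contrary to
      \<open>c < d\<close>.\<close>
    then have T: "c \<in> T" "d \<in> T" "c \<le> a" "a < d" using C(2-5) th by (auto simp: half_lift_def)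
    have "b \<le> d"
    proof (rule ccontr)
      assume "\<not> b \<le> d"
      then have "d < b" by simp
      then have "T \<noteq> S" using none T by blast
      then have "c \<noteq> a" using unique[OF half(1) S(1) T(1)] S(2) by blast
      then have "c < a" using T(3) by simp
      then show False using NC_noncrossing[OF nc half(1) S(1) T(1,2) S(2,3)] T(4) \<open>d < b\<close> \<open>T \<noteq> S\<close> by blast
    qed
    then show ?thesis using T(3) by blast
  qed
  ultimately show ?thesis using S(4) unfolding Edge_Mark e is_mark.simps by blast
qed

end

text \<open>By uniqueness any mark that passes \<open>is_mark\<close> is the mark computed by
  \<open>psi_B\<close>; for unfolded partitions the given mark is such a one.\<close>

lemma psi_B_eq: "\<pi> \<in> NC_B n \<Longrightarrow> is_mark \<pi> x \<Longrightarrow> psi_B \<pi> = (abs_blocks \<pi>, x)"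
  using fst_psi_B is_mark_unique[OF NC_B_partition _ is_mark_snd_psi_B] by (metis prod.collapse)

lemma bij_betw_psi_B: "bij_betw psi_B (NC_B n) (NC_marked n)"
proof (rule bij_betw_byWitness[where f' = unfold_marked])
  have psi: "psi_B \<pi> = (abs_blocks \<pi>, snd (psi_B \<pi>))" if "\<pi> \<in> NC_B n" for \<pi>
    by (rule psi_B_eq[OF that is_mark_snd_psi_B[OF that]])
  show "\<forall>\<pi>\<in>NC_B n. unfold_marked (psi_B \<pi>) = \<pi>"
    using psi unfold_marked_abs_blocks is_mark_snd_psi_B by metis
  show "psi_B ` NC_B n \<subseteq> NC_marked n"
    using psi abs_blocks_marked is_mark_snd_psi_B by (metis image_subsetI)
  have inv: "unfold_marked (\<sigma>, x) \<in> NC_B n \<and> psi_B (unfold_marked (\<sigma>, x)) = (\<sigma>, x)"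
    if "(\<sigma>, x) \<in> NC_marked n" for \<sigma> x
  proof -
    interpret marked_partition n \<sigma> x by unfold_locales (rule that)
    show ?thesis using unfold_NC_B psi_B_eq[OF unfold_NC_B is_mark_unfold] abs_unfold by simp
  qed
  then show "\<forall>y\<in>NC_marked n. psi_B (unfold_marked y) = y" by auto
  show "unfold_marked ` NC_marked n \<subseteq> NC_B n" using inv by auto
qed

section \<open>Types\<close>

lemma image_filter: "f ` {a \<in> A. P (f a)} = {b \<in> f ` A. P b}"
  by blast

text \<open>Applied to the pairs \<open>{B, neg_set B}\<close> counted by \<open>type_of_B\<close>
  and to the sets of absolute values counted by \<open>type_of_sets\<close>: two labellings of the
  same classes of blocks.\<close>

lemma card_image_eq_if_same_fibers:
  assumes "finite A" and fib: "\<And>x y. \<lbrakk>x \<in> A; y \<in> A\<rbrakk> \<Longrightarrow> f x = f y \<longleftrightarrow> g x = g y"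
  shows "card (f ` A) = card (g ` A)"
proof (rule bij_betw_same_card)
  show "bij_betw (\<lambda>z. g (inv_into A f z)) (f ` A) (g ` A)"
    unfolding bij_betw_def
  proof
    have inv: "inv_into A f z \<in> A \<and> f (inv_into A f z) = z" if "z \<in> f ` A" for z
      using that inv_into_into f_inv_into_f by metis
    show "inj_on (\<lambda>z. g (inv_into A f z)) (f ` A)"
      using inv fib by (intro inj_onI) metis
    have "g (inv_into A f (f a)) = g a" if "a \<in> A" for a
      using inv[of "f a"] fib[of "inv_into A f (f a)" a] that by auto
    then show "(\<lambda>z. g (inv_into A f z)) ` f ` A = g ` A"
      by (simp add: image_image)
  qed
qed

lemma type_of_B_eq:
  assumes nc: "\<pi> \<in> NC_B n"
  shows "type_of_B \<pi> = type_of_sets ((\<lambda>B. abs ` B) ` {B \<in> \<pi>. neg_set B \<noteq> B})"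
proof (rule multiset_eqI)
  fix i
  note p = NC_B_partition[OF nc]
  define M where "M = {B \<in> \<pi>. neg_set B \<noteq> B \<and> card B = i}"
  let ?\<sigma> = "(\<lambda>B. abs ` B) ` {B \<in> \<pi>. neg_set B \<noteq> B}"
  have fin: "finite \<pi>" by (rule partition_B_finite[OF p])
  have card: "card (abs ` B) = card B" if B: "B \<in> \<pi>" "neg_set B \<noteq> B" for B
  proof (rule card_image, rule inj_onI)
    fix y z assume yz: "y \<in> B" "z \<in> B" "\<bar>y\<bar> = \<bar>z\<bar>"
    have "- y \<noteq> z" using partition_B_zeroI[OF p B(1) yz(1)] B(2) yz(2) by blast
    then show "y = z" using yz(3) by (auto simp: abs_if split: if_splits)
  qed
  have "{{B, neg_set B} |B. B \<in> \<pi> \<and> B \<noteq> neg_set B \<and> card B = i} = (\<lambda>B. {B, neg_set B}) ` M"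
    unfolding M_def by (auto simp: eq_commute[of "neg_set _"])
  then have "count (type_of_B \<pi>) i = card ((\<lambda>B. {B, neg_set B}) ` M)"
    using count_type_of_B[OF fin] by simp
  also have "\<dots> = card ((\<lambda>B. abs ` B) ` M)"
  proof (rule card_image_eq_if_same_fibers)
    show "finite M" using fin by (simp add: M_def)
    fix B C assume BC: "B \<in> M" "C \<in> M"
    then have "B \<in> \<pi>" "C \<in> \<pi>" by (auto simp: M_def)
    show "{B, neg_set B} = {C, neg_set C} \<longleftrightarrow> abs ` B = abs ` C"
    proof
      assume "{B, neg_set B} = {C, neg_set C}"
      then have "B = C \<or> B = neg_set C" by blast
      then show "abs ` B = abs ` C" using abs_image_neg_set by metis
    next
      assume eq: "abs ` B = abs ` C"
      obtain y where "y \<in> B" using partition_B_nonempty[OF p \<open>B \<in> \<pi>\<close>] by blast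
      then have "\<bar>y\<bar> \<in> abs ` B" by blast
      then have "C = B \<or> C = neg_set B"
        using abs_image_eqD[OF p \<open>B \<in> \<pi>\<close> \<open>C \<in> \<pi>\<close>] eq by metis
      then show "{B, neg_set B} = {C, neg_set C}"
        by (elim disjE) (simp_all add: insert_commute)
    qed
  qed
  also have "(\<lambda>B. abs ` B) ` M = {S \<in> ?\<sigma>. card S = i}"
  proof -
    \<comment> \<open>A nonzero block has as many elements as absolute values, so the size condition
      becomes one on the image.\<close>
    have "M = {B \<in> {B \<in> \<pi>. neg_set B \<noteq> B}. card (abs ` B) = i}"
      using card unfolding M_def by (simp cong: conj_cong)
    then show ?thesis by (simp only: image_filter[of _ _ "\<lambda>S. card S = i"])
  qed
  also have "card \<dots> = count (type_of_sets ?\<sigma>) i"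
    using fin unfolding type_of_sets_def by (simp add: count_image_mset' eq_commute[of i])
  finally show "count (type_of_B \<pi>) i = count (type_of_sets ?\<sigma>) i" .
qed

theorem theorem6p2:
  fixes n :: nat
  assumes "n \<ge> 1"
  shows "bij_betw psi_B (NC_B n) (NC_marked n) \<and>
    (\<forall>\<pi>\<in>NC_B n. \<forall>\<sigma> x. psi_B \<pi> = (\<sigma>, x) \<longrightarrow>
       ((\<nexists>A. x = Block_Mark A) \<longrightarrow> type_of_B \<pi> = type_of_sets \<sigma>) \<and>
       (\<forall>A. x = Block_Mark A \<longrightarrow> type_of_B \<pi> = type_of_sets (\<sigma> - {A})))"
proof (intro conjI ballI allI impI)
  show "bij_betw psi_B (NC_B n) (NC_marked n)" by (rule bij_betw_psi_B)
next
  fix \<pi> \<sigma> x assume nc: "\<pi> \<in> NC_B n" and psi: "psi_B \<pi> = (\<sigma>, x)"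
  have \<sigma>: "\<sigma> = (\<lambda>B. abs ` B) ` \<pi>" and m: "is_mark \<pi> x"
    using fst_psi_B[OF nc] is_mark_snd_psi_B[OF nc] psi unfolding abs_blocks_def by simp_all
  have zero: "x = Block_Mark (abs ` B) \<longleftrightarrow> neg_set B = B" if "B \<in> \<pi>" for B
    by (rule is_mark_zero_block[OF NC_B_partition[OF nc] m that])
  show "type_of_B \<pi> = type_of_sets \<sigma>" if "\<nexists>A. x = Block_Mark A"
  proof -
    have "{B \<in> \<pi>. neg_set B \<noteq> B} = \<pi>" using zero that by blast
    then show ?thesis using type_of_B_eq[OF nc] \<sigma> by simp
  qed
  show "type_of_B \<pi> = type_of_sets (\<sigma> - {A})" if "x = Block_Mark A" for A
  proof -
    \<comment> \<open>The marked block is the set of absolute values of the zero block and of no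
      other, so removing \<open>A\<close> discards exactly the block that \<open>type_of_B\<close>
      ignores.\<close>
    have "neg_set B \<noteq> B \<longleftrightarrow> abs ` B \<noteq> A" if "B \<in> \<pi>" for B
      using zero[OF that] \<open>x = Block_Mark A\<close> by auto
    then have "{B \<in> \<pi>. neg_set B \<noteq> B} = {B \<in> \<pi>. abs ` B \<noteq> A}" by (intro Collect_cong conj_cong refl)
    then have "(\<lambda>B. abs ` B) ` {B \<in> \<pi>. neg_set B \<noteq> B} = \<sigma> - {A}"
      unfolding \<sigma> by (simp only: image_filter[of _ _ "\<lambda>S. S \<noteq> A"] set_diff_eq singleton_iff)
    then show ?thesis using type_of_B_eq[OF nc] by simp
  qed
qed

end
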